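(* Suppose that we have a sparse linear regression model $y_i=\mathbf{x}_i^T\boldsymbol{\beta}^*+\epsilon_i$, where $\mathbf{x}_i\in\mathbb{R}^p$, $i=1,2,\dots$, is a random vector independently drawn from the multivariate Gaussian distribution $N(0,\boldsymbol{\Sigma})$, and the random noise $\epsilon_i$ is sub-Gaussian with parameter $\sigma$. Let $S_{\boldsymbol{\beta}^*}=\{j:\beta_j^*\neq 0\}$ and $|S_{\boldsymbol{\beta}^*}|=k^*$. Assume that $p/n\to 0$ when $n\to+\infty$. Let $\hat{\boldsymbol{\beta}}$ be the ordinary least squares estimator computed from $n$ observations. a) If $$\min_{j\in S_{\boldsymbol{\beta}^*}}|\beta_j^*|>4\sigma\sqrt{\frac{\log(p)}{n\lambda}},\quad\text{where }0<\lambda<\lambda_{\min}(\boldsymbol{\Sigma}),$$ then with probability at least $1-\exp(-p)-2\exp(-\log(p))$, the index set of the top $k^*$ values of the vector $|\hat{\boldsymbol{\beta}}|=(|\hat\beta_1|,\dots,|\hat\beta_p|)$ is exactly $S_{\boldsymbol{\beta}^*}$. b) If $$\min_{j\in S_{\boldsymbol{\beta}^*}}|\beta_j^*|>4\sigma\sqrt{\frac{p}{n\lambda}},\quad\text{where }0<\lambda<\lambda_{\min}(\boldsymbol{\Sigma}),$$ then with probability at least $1-\exp(-p)-2p\exp(-2p)$, the index set of the top $k^*$ values of the vector $|\hat{\boldsymbol{\beta}}|$ is exactly $S_{\boldsymbol{\beta}^*}$.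
   Context: Sub-Gaussian with parameter $\sigma$ is meant in the usual sense: $E[e^{t\epsilon}]\le e^{\sigma^2t^2/2}$ for all $t\in\mathbb{R}$. $\lambda_{\min}(\boldsymbol{\Sigma})$ is the smallest eigenvalue of the covariance matrix $\boldsymbol{\Sigma}$. The ordinary least squares estimator is the solution of $\mathbf{S}_{xx}\hat{\boldsymbol{\beta}}=\mathbf{S}_{xy}$ with $\mathbf{S}_{xx}=\frac1n\sum_{i=1}^n\mathbf{x}_i\mathbf{x}_i^T$ and $\mathbf{S}_{xy}=\frac1n\sum_{i=1}^n y_i\mathbf{x}_i$. *)

theory Defs
  imports "HOL-Probability.Probability" "Jordan_Normal_Form.Spectral_Radius"
begin

text \<open>
  The dimension varies with the sample size, so vectors and matrices are those of
  \<^theory>\<open>Jordan_Normal_Form.Matrix\<close> (indices start at 0). Their type carries no topology;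
  the Borel sigma-algebra on vectors of dimension p is pulled back from the product of
  p copies of the Borel sets.
\<close>

unbundle no inner_syntax and no vec_syntax

definition vec_borel :: "nat \<Rightarrow> real Matrix.vec measure" where
  "vec_borel p = vimage_algebra (carrier_vec p) (\<lambda>v. \<lambda>j\<in>{..<p}. v $ j) (\<Pi>\<^sub>M j\<in>{..<p}. borel)"

text \<open>The law N(m, v) with mean m and variance v; for v = 0 it is the point mass at m.\<close>

definition normal_law :: "real \<Rightarrow> real \<Rightarrow> real measure" where
  "normal_law m v =
     (if v = 0 then return borel m else density lborel (\<lambda>t. ennreal (normal_density m (sqrt v) t)))"

definition covariance_matrix :: "nat \<Rightarrow> real mat \<Rightarrow> bool" where
  "covariance_matrix p A \<longleftrightarrow>
     A \<in> carrier_mat p p \<and> A\<^sup>T = A \<and> (\<forall>u\<in>carrier_vec p. 0 \<le> u \<bullet> (A *\<^sub>v u))"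

text \<open>
  Gaussian vectors through their one-dimensional marginals: every linear combination of the
  components of X is normal (or constant) with the mean and variance given by m and A.
  This needs no density, so singular A is covered.
\<close>

definition multivariate_normal ::
    "'a measure \<Rightarrow> nat \<Rightarrow> real Matrix.vec \<Rightarrow> real mat \<Rightarrow> ('a \<Rightarrow> real Matrix.vec) \<Rightarrow> bool" where
  "multivariate_normal M p m A X \<longleftrightarrow>
     m \<in> carrier_vec p \<and> covariance_matrix p A \<and> X \<in> M \<rightarrow>\<^sub>M vec_borel p \<and>
     (\<forall>u\<in>carrier_vec p. distr M borel (\<lambda>\<omega>. u \<bullet> X \<omega>) = normal_law (u \<bullet> m) (u \<bullet> (A *\<^sub>v u)))"

text \<open>Integrability is explicit because the Bochner integral of a non-integrable function is 0.\<close>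

definition sub_gaussian :: "'a measure \<Rightarrow> real \<Rightarrow> ('a \<Rightarrow> real) \<Rightarrow> bool" where
  "sub_gaussian M s Z \<longleftrightarrow>
     Z \<in> borel_measurable M \<and>
     (\<forall>t. integrable M (\<lambda>\<omega>. exp (t * Z \<omega>)) \<and>
          (\<integral>\<omega>. exp (t * Z \<omega>) \<partial>M) \<le> exp (s\<^sup>2 * t\<^sup>2 / 2))"

text \<open>
  Mutual independence of all the X i and Z i with i in I. It is stated through the generated
  sigma-algebras because \<^const>\<open>prob_space.indep_vars\<close> requires all variables to have
  values in the same type.
\<close>

definition indep_design_noise ::
    "'a measure \<Rightarrow> nat \<Rightarrow> nat set \<Rightarrow> (nat \<Rightarrow> 'a \<Rightarrow> real Matrix.vec) \<Rightarrow> (nat \<Rightarrow> 'a \<Rightarrow> real) \<Rightarrow> bool" where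
  "indep_design_noise M p I X Z \<longleftrightarrow>
     prob_space.indep_sets M
       (case_sum (\<lambda>i. sets (vimage_algebra (space M) (X i) (vec_borel p)))
                 (\<lambda>i. sets (vimage_algebra (space M) (Z i) borel)))
       (I <+> I)"

definition lambda_min :: "real mat \<Rightarrow> real" where
  "lambda_min A = Min (spectrum A)"

definition S_xx :: "nat \<Rightarrow> nat \<Rightarrow> (nat \<Rightarrow> real Matrix.vec) \<Rightarrow> real mat" where
  "S_xx n p x = Matrix.mat p p (\<lambda>(j, k). (1 / real n) * (\<Sum>i=1..n. x i $ j * x i $ k))"

definition S_xy :: "nat \<Rightarrow> nat \<Rightarrow> (nat \<Rightarrow> real Matrix.vec) \<Rightarrow> (nat \<Rightarrow> real) \<Rightarrow> real Matrix.vec" where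
  "S_xy n p x y = Matrix.vec p (\<lambda>j. (1 / real n) * (\<Sum>i=1..n. y i * x i $ j))"

definition is_OLS ::
    "nat \<Rightarrow> nat \<Rightarrow> (nat \<Rightarrow> real Matrix.vec) \<Rightarrow> (nat \<Rightarrow> real) \<Rightarrow> real Matrix.vec \<Rightarrow> bool" where
  "is_OLS n p x y b \<longleftrightarrow> b \<in> carrier_vec p \<and> S_xx n p x *\<^sub>v b = S_xy n p x y"

definition supp_vec :: "real Matrix.vec \<Rightarrow> nat set" where
  "supp_vec b = {j. j < dim_vec b \<and> b $ j \<noteq> 0}"

text \<open>
  T is the index set of the top k values of v. The inequality is strict, so that the top k
  indices are determined without tie-breaking and at most one T qualifies.
\<close>

definition is_top_index_set :: "nat \<Rightarrow> real Matrix.vec \<Rightarrow> nat set \<Rightarrow> bool" where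
  "is_top_index_set k v T \<longleftrightarrow>
     T \<subseteq> {..<dim_vec v} \<and> card T = k \<and> (\<forall>i\<in>T. \<forall>j\<in>{..<dim_vec v} - T. v $ j < v $ i)"

end

theory Submission
  imports Defs
begin

text \<open>
  On the event that \<open>S_xx\<close> is at least \<open>3/4 \<Sigma>\<close> as a quadratic form, the error of least squares
  is a linear image of the noise with weights depending on the design only, hence conditionally
  sub-Gaussian. If the top indices are wrong, some \<open>i\<close> in the support and \<open>j\<close> outside it satisfy
  \<open>|d i| + |d j| \<ge> |\<beta> i|\<close> for the error \<open>d\<close>, that is, one of two signed contrasts of \<open>d i\<close> and \<open>d j\<close>
  is large. A Chernoff bound for each of the at most \<open>2 p\<^sup>2\<close> contrasts gives the failure
  probability \<open>2 p\<^sup>2 exp (- 3 q)\<close>, with \<open>q = ln p\<close> in part a) and \<open>q = p\<close> in part b).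

  The design event fails with probability at most \<open>exp (- p)\<close> once \<open>n \<ge> 4800 p\<close>. In coordinates in
  which \<open>\<Sigma>\<close> is the identity, chi-square tails and a union bound control the quadratic form at the
  \<open>exp (O p)\<close> integer points of norm at most \<open>2 \<surd>p\<close>, and rounding a vector of norm \<open>\<surd>p\<close> coordinate
  by coordinate to an integer point transfers the lower bound to all vectors.
\<close>

section \<open>Quadratic forms on integer points\<close>

text \<open>The constant 4 in the signal condition and the failure term 2 exp (- ln p) leave little
  room. If the design form is at least c n l |u|^2, a contrast with |h|^2 = 2 has variance proxy 2
  \<sigma>^2 / (c n l), and its Chernoff exponent at the threshold 4 \<sigma> sqrt (q / (n l)) is 4
  c q. With 2 p^2 contrasts and q = ln p this has to stay below 2 / p, so c = 3/4 is the smallest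
  factor that serves. The design constants are arranged around it: 5/6 on integer points, minus a
  rounding loss of (7/6 - 5/6) / 4. The other obstacle is uniformity. \<Sigma>, \<sigma>, \<beta>
  and l may change with n in any way, so no constant may depend on the conditioning of \<Sigma>.
  Whitening removes \<Sigma> from the design estimate, and l enters again only by comparing the form
  of \<Sigma> with l |u|^2.\<close>

definition lattice_ball :: "nat \<Rightarrow> (nat \<Rightarrow> int) set" where
  "lattice_ball m =
     {z \<in> {..<m} \<rightarrow>\<^sub>E {- int (4 * m)..int (4 * m)}. (\<Sum>j<m. (z j)\<^sup>2) \<le> int (4 * m)}"

lemma finite_lattice_ball: "finite (lattice_ball m)"
  unfolding lattice_ball_def by (simp add: finite_PiE)

lemma int_abs_le_square: "\<bar>k\<bar> \<le> (k :: int)\<^sup>2"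
proof (cases "k = 0")
  case False
  then have "1 * \<bar>k\<bar> \<le> \<bar>k\<bar> * \<bar>k\<bar>" by (intro mult_right_mono) auto
  then show ?thesis by (simp add: power2_eq_square)
qed simp

text \<open>After \<open>int_abs_le_square\<close> this is a two-sided geometric series with ratio
  at most 1/2, bounded by 2 + 2 uniformly in K. The form exp 2 lets m coordinates contribute exp (2
  m) in \<open>card_lattice_ball\<close>.\<close>

lemma sum_exp_neg_square_le: "(\<Sum>k\<in>{- int K..int K}. exp (- (real_of_int k)\<^sup>2)) \<le> exp 2"
proof -
  have geo: "(\<Sum>k\<le>K. exp (- real k)) \<le> 2" for K
  proof -
    have e2: "exp (- 1) \<le> (1 / 2 :: real)"
      using exp_ge_add_one_self[of 1] by (simp add: exp_minus field_simps)
    have "(\<Sum>k\<le>K. exp (- real k)) \<le> (\<Sum>k\<le>K. (1 / 2) ^ k)"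
    proof (rule sum_mono)
      fix k
      have "exp (- real k) = exp (- 1) ^ k" by (simp add: exp_of_nat_mult[symmetric])
      also have "\<dots> \<le> (1 / 2) ^ k" by (rule power_mono[OF e2]) simp
      finally show "exp (- real k) \<le> (1 / 2) ^ k" .
    qed
    also have "\<dots> = 2 - (1 / 2) ^ K" by (induction K) auto
    also have "\<dots> \<le> 2" by simp
    finally show ?thesis .
  qed
  have "(\<Sum>k\<in>{- int K..int K}. exp (- (real_of_int k)\<^sup>2))
      \<le> (\<Sum>k\<in>{- int K..int K}. exp (- \<bar>real_of_int k\<bar>))"
  proof (rule sum_mono)
    fix k :: int
    have "\<bar>k\<bar> \<le> k\<^sup>2" by (rule int_abs_le_square)
    then have "real_of_int \<bar>k\<bar> \<le> real_of_int (k\<^sup>2)" by (rule of_int_le_iff[THEN iffD2])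
    then show "exp (- (real_of_int k)\<^sup>2) \<le> exp (- \<bar>real_of_int k\<bar>)" by simp
  qed
  also have "\<dots> \<le> (\<Sum>k\<in>int ` {..K} \<union> (\<lambda>k. - int k) ` {..K}. exp (- \<bar>real_of_int k\<bar>))"
  proof (rule sum_mono2)
    show "{- int K..int K} \<subseteq> int ` {..K} \<union> (\<lambda>k. - int k) ` {..K}"
    proof
      fix k assume "k \<in> {- int K..int K}"
      then have "nat \<bar>k\<bar> \<le> K" "k = int (nat \<bar>k\<bar>) \<or> k = - int (nat \<bar>k\<bar>)" by auto
      then show "k \<in> int ` {..K} \<union> (\<lambda>k. - int k) ` {..K}" by blast
    qed
  qed auto
  also have "\<dots> \<le> (\<Sum>k\<in>int ` {..K}. exp (- \<bar>real_of_int k\<bar>))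
      + (\<Sum>k\<in>(\<lambda>k. - int k) ` {..K}. exp (- \<bar>real_of_int k\<bar>))"
    by (simp add: sum_Un sum_nonneg)
  also have "\<dots> = 2 * (\<Sum>k\<le>K. exp (- real k))"
    by (simp add: sum.reindex inj_on_def)
  also have "\<dots> \<le> 4" using geo[of K] by simp
  also have "(4::real) \<le> exp 2"
  proof -
    have "(2::real) \<le> exp 1" using exp_ge_add_one_self[of 1] by simp
    then have "(2::real) * 2 \<le> exp 1 * exp 1" by (intro mult_mono) auto
    then show ?thesis by (simp add: exp_add[symmetric])
  qed
  finally show ?thesis .
qed

text \<open>On the ball each point has weight \<open>exp (4 m - |z|\<^sup>2) \<ge> 1\<close>, and the total weight of the
  surrounding box factorises over the coordinates.\<close>

lemma card_lattice_ball: "real (card (lattice_ball m)) \<le> exp (6 * real m)"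
proof -
  let ?B = "{- int (4 * m)..int (4 * m)}"
  have "real (card (lattice_ball m)) = (\<Sum>z\<in>lattice_ball m. 1)" by simp
  also have "\<dots> \<le> (\<Sum>z\<in>lattice_ball m. exp (4 * real m) * (\<Prod>j<m. exp (- (real_of_int (z j))\<^sup>2)))"
  proof (rule sum_mono)
    fix z assume "z \<in> lattice_ball m"
    then have "(\<Sum>j<m. (z j)\<^sup>2) \<le> int (4 * m)" by (simp add: lattice_ball_def)
    then have "real_of_int (\<Sum>j<m. (z j)\<^sup>2) \<le> real_of_int (int (4 * m))" by (rule of_int_le_iff[THEN iffD2])
    then have "(\<Sum>j<m. (real_of_int (z j))\<^sup>2) \<le> 4 * real m" by simp
    then have "1 \<le> exp (4 * real m - (\<Sum>j<m. (real_of_int (z j))\<^sup>2))" by simp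
    also have "\<dots> = exp (4 * real m) * (\<Prod>j<m. exp (- (real_of_int (z j))\<^sup>2))"
      by (simp add: exp_sum[symmetric] exp_add[symmetric] sum_negf)
    finally show "1 \<le> exp (4 * real m) * (\<Prod>j<m. exp (- (real_of_int (z j))\<^sup>2))" .
  qed
  also have "\<dots> \<le> (\<Sum>z\<in>{..<m} \<rightarrow>\<^sub>E ?B. exp (4 * real m) * (\<Prod>j<m. exp (- (real_of_int (z j))\<^sup>2)))"
  proof (rule sum_mono2)
    show "finite ({..<m} \<rightarrow>\<^sub>E ?B)" by (rule finite_PiE) auto
    show "lattice_ball m \<subseteq> {..<m} \<rightarrow>\<^sub>E ?B" by (auto simp: lattice_ball_def)
    show "0 \<le> exp (4 * real m) * (\<Prod>j<m. exp (- (real_of_int (z j))\<^sup>2))" for z :: "nat \<Rightarrow> int"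
      by (intro mult_nonneg_nonneg prod_nonneg) auto
  qed
  also have "\<dots> = exp (4 * real m) * (\<Prod>j<m. \<Sum>k\<in>?B. exp (- (real_of_int k)\<^sup>2))"
    by (subst prod_sum_PiE) (simp_all only: sum_distrib_left finite_lessThan finite_atLeastAtMost_int)
  also have "\<dots> \<le> exp (4 * real m) * exp 2 ^ m"
  proof (intro mult_left_mono)
    show "(\<Prod>j<m. \<Sum>k\<in>?B. exp (- (real_of_int k)\<^sup>2)) \<le> exp 2 ^ m"
      using power_mono[OF sum_exp_neg_square_le[of "4 * m"], of m] by (simp add: sum_nonneg)
  qed simp
  also have "\<dots> = exp (6 * real m)"
    by (simp add: exp_of_nat_mult[symmetric] exp_add[symmetric] algebra_simps)
  finally show ?thesis .
qed

text \<open>Rounding t down with probability 1 - r and up with probability r, where r is the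
  fractional part, keeps the mean and has variance r (1 - r) \<le> 1/4. The expected value of the
  quadratic rises by \<alpha> r (1 - r), so one of the two outcomes rises by no more than that. A
  negative \<alpha> is covered, as \<kappa> only bounds it from above.\<close>

lemma quadratic_rounding:
  fixes \<alpha> \<beta> \<gamma> \<kappa> t :: real
  assumes "\<alpha> \<le> \<kappa>" "0 \<le> \<kappa>"
  obtains k :: int where "\<bar>real_of_int k - t\<bar> \<le> 1"
    "\<alpha> * (real_of_int k)\<^sup>2 + \<beta> * real_of_int k + \<gamma> \<le> \<alpha> * t\<^sup>2 + \<beta> * t + \<gamma> + \<kappa> / 4"
proof -
  define f where "f s = \<alpha> * s\<^sup>2 + \<beta> * s + \<gamma>" for s
  define a where "a = real_of_int \<lfloor>t\<rfloor>"
  define r where "r = t - a"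
  have r: "0 \<le> r" "r < 1" unfolding r_def a_def by linarith+
  have t: "t = a + r" by (simp add: r_def)
  have rr: "r * (1 - r) \<le> 1 / 4"
    using zero_le_power2[of "r - 1/2"] by (simp add: power2_eq_square algebra_simps)
  have "(1 - r) * f a + r * f (a + 1) = f t + \<alpha> * (r * (1 - r))"
    unfolding f_def t by (simp add: power2_eq_square algebra_simps)
  also have "\<dots> \<le> f t + \<kappa> * (r * (1 - r))"
    using assms r by (intro add_left_mono mult_right_mono) auto
  also have "\<dots> \<le> f t + \<kappa> / 4" using mult_left_mono[OF rr assms(2)] by simp
  finally have avg: "(1 - r) * f a + r * f (a + 1) \<le> f t + \<kappa> / 4" .
  have "f a \<le> f t + \<kappa> / 4 \<or> f (a + 1) \<le> f t + \<kappa> / 4"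
  proof (rule ccontr)
    assume "\<not> ?thesis"
    then have *: "f t + \<kappa> / 4 < f a" "f t + \<kappa> / 4 < f (a + 1)" by auto
    have "(1 - r) * (f t + \<kappa> / 4) + r * (f t + \<kappa> / 4) < (1 - r) * f a + r * f (a + 1)"
      by (rule add_less_le_mono[OF mult_strict_left_mono[OF *(1)] mult_left_mono[OF less_imp_le[OF *(2)]]])
        (use r in auto)
    moreover have "(1 - r) * (f t + \<kappa> / 4) + r * (f t + \<kappa> / 4) = f t + \<kappa> / 4"
      by (simp add: left_diff_distrib)
    ultimately show False using avg by linarith
  qed
  then show thesis
  proof
    assume "f a \<le> f t + \<kappa> / 4"
    then show thesis using that[of "\<lfloor>t\<rfloor>"] r unfolding f_def a_def r_def by auto
  next
    assume "f (a + 1) \<le> f t + \<kappa> / 4"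
    then show thesis using that[of "\<lfloor>t\<rfloor> + 1"] r unfolding f_def a_def r_def by auto
  qed
qed

text \<open>Coordinates are rounded in turn, each choice being made against those already rounded.
  Cross terms of \<open>F\<close> go into the linear coefficient of the current coordinate and cost
  nothing, so \<open>quad\<close> limits only the coefficient of t^2. It is required at every
  \<open>z\<close> because the sections change as earlier coordinates move.\<close>

lemma coordinatewise_rounding:
  fixes F :: "(nat \<Rightarrow> real) \<Rightarrow> real"
  assumes quad: "\<And>z j. j < m \<Longrightarrow> \<exists>\<alpha> \<beta> \<gamma>. \<alpha> \<le> \<kappa> \<and> (\<forall>t. F (z(j := t)) = \<alpha> * t\<^sup>2 + \<beta> * t + \<gamma>)"
    and \<kappa>: "0 \<le> \<kappa>"
  shows "\<exists>z. (\<forall>j<m. z j \<in> \<int> \<and> \<bar>z j - w j\<bar> \<le> 1) \<and> F z \<le> F w + real m * \<kappa> / 4"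
proof -
  have "k \<le> m \<Longrightarrow> \<exists>z. (\<forall>j<k. z j \<in> \<int> \<and> \<bar>z j - w j\<bar> \<le> 1) \<and> (\<forall>j\<ge>k. z j = w j)
      \<and> F z \<le> F w + real k * \<kappa> / 4" for k
  proof (induction k)
    case 0
    then show ?case by auto
  next
    case (Suc k)
    then obtain z where z: "\<forall>j<k. z j \<in> \<int> \<and> \<bar>z j - w j\<bar> \<le> 1" "\<forall>j\<ge>k. z j = w j"
      "F z \<le> F w + real k * \<kappa> / 4" by auto
    obtain \<alpha> \<beta> \<gamma> where q: "\<alpha> \<le> \<kappa>" "\<And>t. F (z(k := t)) = \<alpha> * t\<^sup>2 + \<beta> * t + \<gamma>"
      using quad[of k z] Suc.prems by auto
    obtain l :: int where l: "\<bar>real_of_int l - w k\<bar> \<le> 1"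
      "\<alpha> * (real_of_int l)\<^sup>2 + \<beta> * real_of_int l + \<gamma> \<le> \<alpha> * (w k)\<^sup>2 + \<beta> * w k + \<gamma> + \<kappa> / 4"
      using quadratic_rounding[OF q(1) \<kappa>, of "w k" \<beta> \<gamma>] by blast
    have "z(k := w k) = z" using z(2) by auto
    then have "F (z(k := real_of_int l)) \<le> F z + \<kappa> / 4"
      using l(2) q(2)[of "real_of_int l"] q(2)[of "w k"] by simp
    also have "\<dots> \<le> F w + real (Suc k) * \<kappa> / 4" using z(3) by (simp add: field_simps)
    finally have "F (z(k := real_of_int l)) \<le> F w + real (Suc k) * \<kappa> / 4" .
    moreover have "\<forall>j<Suc k. (z(k := real_of_int l)) j \<in> \<int> \<and> \<bar>(z(k := real_of_int l)) j - w j\<bar> \<le> 1"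
      "\<forall>j\<ge>Suc k. (z(k := real_of_int l)) j = w j"
      using z l(1) by (auto simp: less_Suc_eq)
    ultimately show ?case by blast
  qed
  from this[of m] show ?thesis by auto
qed

text \<open>A coordinatewise rounding of \<open>w\<close> costs at most \<open>m \<kappa> / 4\<close>, which is negligible against
  \<open>\<mu> |w|\<^sup>2\<close> at the scale \<open>|w|\<^sup>2 = m\<close>. No bound on the largest eigenvalue is needed.\<close>

lemma quadratic_form_lower_bound_from_lattice:
  fixes G :: "'i \<Rightarrow> nat \<Rightarrow> real"
  assumes lat: "\<And>z. z \<in> lattice_ball m \<Longrightarrow>
        \<mu> * (\<Sum>j<m. (real_of_int (z j))\<^sup>2) \<le> (\<Sum>i\<in>I. (\<Sum>j<m. real_of_int (z j) * G i j)\<^sup>2)"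
    and diag: "\<And>j. j < m \<Longrightarrow> (\<Sum>i\<in>I. (G i j)\<^sup>2) \<le> \<mu> + \<kappa>"
    and \<kappa>: "0 \<le> \<kappa>"
  shows "(\<mu> - \<kappa> / 4) * (\<Sum>j<m. (w j)\<^sup>2) \<le> (\<Sum>i\<in>I. (\<Sum>j<m. w j * G i j)\<^sup>2)"
proof -
  define Q where "Q w = (\<Sum>i\<in>I. (\<Sum>j<m. w j * G i j)\<^sup>2)" for w
  define F where "F w = Q w - \<mu> * (\<Sum>j<m. (w j)\<^sup>2)" for w
  have quad: "\<exists>\<alpha> \<beta> \<gamma>. \<alpha> \<le> \<kappa> \<and> (\<forall>t. F (z(j := t)) = \<alpha> * t\<^sup>2 + \<beta> * t + \<gamma>)" if "j < m" for z j
  proof -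
    let ?J = "{..<m} - {j}"
    define r where "r i = (\<Sum>k\<in>?J. z k * G i k)" for i
    have split: "(\<Sum>k<m. (z(j := t)) k * G i k) = t * G i j + r i" for i t
      using that by (subst sum.remove[of _ j]) (auto simp: r_def intro!: sum.cong)
    have splitn: "(\<Sum>k<m. ((z(j := t)) k)\<^sup>2) = t\<^sup>2 + (\<Sum>k\<in>?J. (z k)\<^sup>2)" for t
      using that by (subst sum.remove[of _ j]) (auto intro!: sum.cong)
    have "F (z(j := t)) = ((\<Sum>i\<in>I. (G i j)\<^sup>2) - \<mu>) * t\<^sup>2 + (\<Sum>i\<in>I. 2 * G i j * r i) * t
        + ((\<Sum>i\<in>I. (r i)\<^sup>2) - \<mu> * (\<Sum>k\<in>?J. (z k)\<^sup>2))" for t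
    proof -
      have "Q (z(j := t)) = (\<Sum>i\<in>I. (G i j)\<^sup>2 * t\<^sup>2 + 2 * G i j * r i * t + (r i)\<^sup>2)"
        unfolding Q_def split by (intro sum.cong refl) (simp add: power2_eq_square algebra_simps)
      also have "\<dots> = (\<Sum>i\<in>I. (G i j)\<^sup>2) * t\<^sup>2 + (\<Sum>i\<in>I. 2 * G i j * r i) * t + (\<Sum>i\<in>I. (r i)\<^sup>2)"
        by (simp only: sum.distrib sum_distrib_right)
      finally show ?thesis unfolding F_def splitn by (simp only: algebra_simps)
    qed
    then show ?thesis using diag[OF that]
      by (intro exI[of _ "(\<Sum>i\<in>I. (G i j)\<^sup>2) - \<mu>"] exI conjI) auto
  qed
  have scale: "Q (\<lambda>j. t * w j) = t\<^sup>2 * Q w" for t w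
    unfolding Q_def by (simp add: sum_distrib_left power_mult_distrib[symmetric] mult.assoc)
  \<comment> \<open>The claim is homogeneous of degree 2, so vectors of squared norm m suffice.
    There the loss m \<kappa> / 4 is \<kappa> / 4 times the squared norm.\<close>
  have sphere: "- (real m * \<kappa> / 4) \<le> F w" if w: "(\<Sum>j<m. (w j)\<^sup>2) = real m" for w
  proof -
    obtain z where z: "\<forall>j<m. z j \<in> \<int> \<and> \<bar>z j - w j\<bar> \<le> 1" "F z \<le> F w + real m * \<kappa> / 4"
      using coordinatewise_rounding[of m \<kappa> F w, OF quad \<kappa>] by blast
    define y where "y = (\<lambda>j\<in>{..<m}. \<lfloor>z j\<rfloor>)"
    have y: "real_of_int (y j) = z j" if "j < m" for j
      using z(1) that by (auto simp: y_def elim!: Ints_cases)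
    \<comment> \<open>Each coordinate moves by at most 1, so |z|^2 \<le> 2 |w|^2 + 2 m = 4 m; this
      is where the radius in \<open>lattice_ball\<close> comes from.\<close>
    have "(\<Sum>j<m. (z j)\<^sup>2) \<le> (\<Sum>j<m. 2 * (w j)\<^sup>2 + 2)"
    proof (rule sum_mono)
      fix j assume "j \<in> {..<m}"
      then have "(z j - w j)\<^sup>2 \<le> 1" using z(1) by (simp add: abs_square_le_1)
      moreover have "(z j)\<^sup>2 \<le> 2 * (w j)\<^sup>2 + 2 * (z j - w j)\<^sup>2"
        using zero_le_power2[of "z j - 2 * w j"] by (simp add: power2_eq_square algebra_simps)
      ultimately show "(z j)\<^sup>2 \<le> 2 * (w j)\<^sup>2 + 2" by linarith
    qed
    also have "\<dots> = 4 * real m" by (simp add: sum.distrib sum_distrib_left[symmetric] w)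
    finally have "real_of_int (\<Sum>j<m. (y j)\<^sup>2) \<le> real_of_int (int (4 * m))"
      by (simp add: y)
    then have ysq: "(\<Sum>j<m. (y j)\<^sup>2) \<le> int (4 * m)" by linarith
    \<comment> \<open>The box in \<open>lattice_ball\<close> excludes nothing: an integer is at most
      its square in absolute value, so the norm bound already confines every coordinate.\<close>
    have "y j \<in> {- int (4 * m)..int (4 * m)}" if "j < m" for j
    proof -
      have "\<bar>y j\<bar> \<le> (y j)\<^sup>2" by (rule int_abs_le_square)
      also have "\<dots> \<le> (\<Sum>j<m. (y j)\<^sup>2)" using that by (intro member_le_sum) auto
      finally show ?thesis using ysq by auto
    qed
    then have "y \<in> lattice_ball m" using ysq by (auto simp: lattice_ball_def y_def)
    from lat[OF this] have "0 \<le> F z" by (simp add: F_def Q_def y)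
    with z(2) show ?thesis by simp
  qed
  define s where "s = (\<Sum>j<m. (w j)\<^sup>2)"
  have s0: "0 \<le> s" by (simp add: s_def sum_nonneg)
  show ?thesis
  proof (cases "s = 0")
    case True
    then show ?thesis by (simp add: s_def sum_nonneg)
  next
    case False
    with s0 have s: "0 < s" by simp
    then have m: "0 < m" unfolding s_def by (cases m) auto
    define t where "t = sqrt (real m / s)"
    have t2: "t\<^sup>2 = real m / s" unfolding t_def using s by simp
    have nw: "(\<Sum>j<m. (t * w j)\<^sup>2) = real m"
      unfolding power_mult_distrib t2 sum_distrib_left[symmetric] s_def[symmetric] using s by simp
    have "- (real m * \<kappa> / 4) \<le> (real m / s) * Q w - \<mu> * real m"
      using sphere[OF nw] unfolding F_def scale nw t2 .
    then have "(real m / s) * ((\<mu> - \<kappa> / 4) * s) \<le> (real m / s) * Q w" using s by (simp add: algebra_simps)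
    then have "(\<mu> - \<kappa> / 4) * s \<le> Q w" by (rule mult_left_le_imp_le) (use s m in simp)
    then show ?thesis by (simp add: s_def Q_def)
  qed
qed

section \<open>Tails of sums of Gaussian squares\<close>

text \<open>Multiplying the N(0, v) density by exp (s t^2) only changes the precision from 1 / v to
  (1 - 2 s v) / v: the product is a constant times another centred normal density, whose mass is 1.
  Here s may be negative.\<close>

lemma nn_integral_exp_square_normal_law:
  assumes v: "0 < v" and s: "2 * s * v < 1"
  shows "(\<integral>\<^sup>+t. ennreal (exp (s * t\<^sup>2)) \<partial>normal_law 0 v) = ennreal (1 / sqrt (1 - 2 * s * v))"
proof -
  define d where "d = 1 - 2 * s * v"
  have d: "0 < d" using s by (simp add: d_def)
  have sq: "(sqrt v)\<^sup>2 = v" "(sqrt (v / d))\<^sup>2 = v / d" using v d by auto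
  have shift: "normal_density 0 (sqrt v) t * exp (s * t\<^sup>2)
      = (1 / sqrt d) * normal_density 0 (sqrt (v / d)) t" for t
  proof -
    have "- t\<^sup>2 / (2 * v) + s * t\<^sup>2 = - (t\<^sup>2) / (2 * (v / d))"
      using v d by (simp add: d_def field_simps)
    moreover have "1 / sqrt (2 * pi * v) = (1 / sqrt d) * (1 / sqrt (2 * pi * (v / d)))"
      using v d by (simp add: real_sqrt_mult real_sqrt_divide field_simps)
    ultimately show ?thesis
      unfolding normal_density_def sq by (simp add: exp_add[symmetric] mult.assoc)
  qed
  have nn1: "(\<integral>\<^sup>+t. ennreal (normal_density 0 (sqrt (v / d)) t) \<partial>lborel) = 1"
    by (subst nn_integral_eq_integral) (use v d in auto)
  have "(\<integral>\<^sup>+t. ennreal (exp (s * t\<^sup>2)) \<partial>normal_law 0 v)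
      = (\<integral>\<^sup>+t. ennreal (normal_density 0 (sqrt v) t) * ennreal (exp (s * t\<^sup>2)) \<partial>lborel)"
    using v by (simp add: normal_law_def nn_integral_density)
  also have "\<dots> = (\<integral>\<^sup>+t. ennreal (1 / sqrt d) * ennreal (normal_density 0 (sqrt (v / d)) t) \<partial>lborel)"
    using d by (intro nn_integral_cong) (simp add: ennreal_mult[symmetric] shift del: times_divide_eq_left)
  also have "\<dots> = ennreal (1 / sqrt d)"
    by (simp add: nn_integral_cmult nn1)
  finally show ?thesis by (simp add: d_def)
qed

context prob_space
begin

text \<open>The tilt is normalised by the variance. A negative \<tau> gives a lower tail, since the
  inequality on the sum reverses, and a positive one an upper tail, so one bound serves both.
  Writing (1 - \<tau>)^(-n/2) through \<open>ln\<close> leaves a numerical estimate of one logarithm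
  in each case.\<close>

lemma gaussian_square_sum_chernoff:
  assumes ind: "indep_vars (\<lambda>_. borel) g I" and fin: "finite I"
    and law: "\<And>i. i \<in> I \<Longrightarrow> distr M borel (g i) = normal_law 0 v"
    and v: "0 < v" and \<tau>: "\<tau> < 1"
  shows "prob {\<omega> \<in> space M. c \<le> \<tau> / (2 * v) * (\<Sum>i\<in>I. (g i \<omega>)\<^sup>2)}
    \<le> exp (- c) * exp (- (real (card I) / 2) * ln (1 - \<tau>))"
proof -
  define s where "s = \<tau> / (2 * v)"
  have sv: "2 * s * v = \<tau>" using v by (simp add: s_def)
  have [measurable]: "g i \<in> borel_measurable M" if "i \<in> I" for i
    using ind that by (auto simp: indep_vars_def)
  have one: "(\<integral>\<^sup>+\<omega>. ennreal (exp (s * (g i \<omega>)\<^sup>2)) \<partial>M) = ennreal (exp (- (1 / 2) * ln (1 - \<tau>)))"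
    if "i \<in> I" for i
  proof -
    have "(\<integral>\<^sup>+\<omega>. ennreal (exp (s * (g i \<omega>)\<^sup>2)) \<partial>M)
        = (\<integral>\<^sup>+t. ennreal (exp (s * t\<^sup>2)) \<partial>distr M borel (g i))"
      using that by (subst nn_integral_distr) auto
    also have "\<dots> = ennreal (1 / sqrt (1 - \<tau>))"
      using nn_integral_exp_square_normal_law[OF v, of s] \<tau> that by (simp add: law sv)
    also have "1 / sqrt (1 - \<tau>) = exp (- (1 / 2) * ln (1 - \<tau>))"
      using \<tau> by (simp add: powr_half_sqrt[symmetric] powr_def exp_minus inverse_eq_divide)
    finally show ?thesis .
  qed
  have "emeasure M {\<omega> \<in> space M. c \<le> s * (\<Sum>i\<in>I. (g i \<omega>)\<^sup>2)}
      = emeasure M {\<omega> \<in> space M. 1 \<le> ennreal (exp (- c)) * ennreal (exp (s * (\<Sum>i\<in>I. (g i \<omega>)\<^sup>2)))}"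
    by (simp add: ennreal_mult[symmetric] exp_add[symmetric])
  also have "\<dots> = emeasure M ({\<omega> \<in> space M. 1 \<le> ennreal (exp (- c)) * ennreal (exp (s * (\<Sum>i\<in>I. (g i \<omega>)\<^sup>2)))} \<inter> space M)"
    by (simp add: Int_def conj_commute cong: conj_cong)
  also have "\<dots> \<le> ennreal (exp (- c)) * (\<integral>\<^sup>+\<omega>. ennreal (exp (s * (\<Sum>i\<in>I. (g i \<omega>)\<^sup>2))) * indicator (space M) \<omega> \<partial>M)"
    by (intro order_trans[OF _ nn_integral_Markov_inequality] emeasure_mono) auto
  also have "(\<integral>\<^sup>+\<omega>. ennreal (exp (s * (\<Sum>i\<in>I. (g i \<omega>)\<^sup>2))) * indicator (space M) \<omega> \<partial>M)
      = (\<integral>\<^sup>+\<omega>. (\<Prod>i\<in>I. ennreal (exp (s * (g i \<omega>)\<^sup>2))) \<partial>M)"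
    by (intro nn_integral_cong) (simp add: prod_ennreal exp_sum[OF fin] sum_distrib_left)
  also have "\<dots> = (\<Prod>i\<in>I. \<integral>\<^sup>+\<omega>. ennreal (exp (s * (g i \<omega>)\<^sup>2)) \<partial>M)"
    by (intro indep_vars_nn_integral[OF fin] indep_vars_compose2[OF ind]) auto
  also have "\<dots> = (\<Prod>i\<in>I. ennreal (exp (- (1 / 2) * ln (1 - \<tau>))))"
    by (intro prod.cong refl one)
  also have "\<dots> = ennreal (exp (- (real (card I) / 2) * ln (1 - \<tau>)))"
    by (simp only: prod_constant ennreal_power exp_ge_zero exp_of_nat_mult[symmetric]) (simp add: mult_ac)
  finally show ?thesis
    unfolding s_def emeasure_eq_measure by (simp add: ennreal_mult[symmetric] ennreal_le_iff)
qed

lemma gaussian_square_sum_lower_tail: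
  assumes ind: "indep_vars (\<lambda>_. borel) g I" and fin: "finite I"
    and law: "\<And>i. i \<in> I \<Longrightarrow> distr M borel (g i) = normal_law 0 v"
    and v: "0 < v"
  shows "prob {\<omega> \<in> space M. (\<Sum>i\<in>I. (g i \<omega>)\<^sup>2) \<le> 5 / 6 * real (card I) * v} \<le> exp (- real (card I) / 600)"
proof -
  let ?n = "real (card I)"
  \<comment> \<open>With \<tau> = - s and ln (1 + s) \<ge> s - s^2 the exponent per observation is 5
    s / 12 - (s - s^2) / 2, which is smallest at s = 1/12, with value - 1/288.\<close>
  have ln: "11 / 144 \<le> ln (1 + 1 / 12 :: real)"
    using ln_one_plus_pos_lower_bound[of "1 / 12 :: real"] by (simp add: power2_eq_square)
  have "{\<omega> \<in> space M. (\<Sum>i\<in>I. (g i \<omega>)\<^sup>2) \<le> 5 / 6 * ?n * v}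
      = {\<omega> \<in> space M. - ?n * 5 / 144 \<le> (- 1 / 12) / (2 * v) * (\<Sum>i\<in>I. (g i \<omega>)\<^sup>2)}"
    using v by (auto simp: field_simps)
  then have "prob {\<omega> \<in> space M. (\<Sum>i\<in>I. (g i \<omega>)\<^sup>2) \<le> 5 / 6 * ?n * v}
      \<le> exp (- (- ?n * 5 / 144)) * exp (- (?n / 2) * ln (1 - (- 1 / 12)))"
    using gaussian_square_sum_chernoff[OF ind fin law v, of "- 1 / 12" "- ?n * 5 / 144"] by simp
  also have "\<dots> = exp (?n * 5 / 144 - (?n / 2) * ln (1 + 1 / 12))"
    by (simp add: exp_add[symmetric])
  also have "\<dots> \<le> exp (- ?n / 600)"
    using mult_left_mono[OF ln, of "?n / 2"] by simp
  finally show ?thesis .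
qed

lemma gaussian_square_sum_upper_tail:
  assumes ind: "indep_vars (\<lambda>_. borel) g I" and fin: "finite I"
    and law: "\<And>i. i \<in> I \<Longrightarrow> distr M borel (g i) = normal_law 0 v"
    and v: "0 < v"
  shows "prob {\<omega> \<in> space M. 7 / 6 * real (card I) * v \<le> (\<Sum>i\<in>I. (g i \<omega>)\<^sup>2)} \<le> exp (- real (card I) / 600)"
proof -
  let ?n = "real (card I)"
  \<comment> \<open>With ln (1 - \<tau>) \<ge> - \<tau> - 2 \<tau>^2 the exponent per observation is
    - \<tau> / 12 + \<tau>^2, smallest at \<tau> = 1/24 with value - 1/576. The rate 1/600 is a
    common rounding for both tails.\<close>
  have ln: "- (13 / 288) \<le> ln (1 - 1 / 24 :: real)"
    using ln_one_minus_pos_lower_bound[of "1 / 24 :: real"] by (simp add: power2_eq_square)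
  have "{\<omega> \<in> space M. 7 / 6 * ?n * v \<le> (\<Sum>i\<in>I. (g i \<omega>)\<^sup>2)}
      = {\<omega> \<in> space M. ?n * 7 / 288 \<le> (1 / 24) / (2 * v) * (\<Sum>i\<in>I. (g i \<omega>)\<^sup>2)}"
    using v by (auto simp: field_simps)
  then have "prob {\<omega> \<in> space M. 7 / 6 * ?n * v \<le> (\<Sum>i\<in>I. (g i \<omega>)\<^sup>2)}
      \<le> exp (- (?n * 7 / 288)) * exp (- (?n / 2) * ln (1 - 1 / 24))"
    using gaussian_square_sum_chernoff[OF ind fin law v, of "1 / 24" "?n * 7 / 288"] by simp
  also have "\<dots> = exp (- (?n * 7 / 288) - (?n / 2) * ln (1 - 1 / 24))"
    by (simp add: exp_add[symmetric])
  also have "\<dots> \<le> exp (- ?n / 600)"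
    using mult_left_mono[OF ln, of "?n / 2"] by simp
  finally show ?thesis .
qed

end

section \<open>Covariance matrices\<close>

text \<open>Cramer's rule. The solution is a rational expression in the entries of \<open>A\<close>,
  which is what later makes the least squares weights measurable.\<close>

lemma mult_mat_vec_adj_solution:
  fixes A :: "'a :: field mat"
  assumes A: "A \<in> carrier_mat n n" and det: "det A \<noteq> 0" and h: "h \<in> carrier_vec n"
  shows "A *\<^sub>v (inverse (det A) \<cdot>\<^sub>v (adj_mat A *\<^sub>v h)) = h"
proof -
  have "A *\<^sub>v (adj_mat A *\<^sub>v h) = (A * adj_mat A) *\<^sub>v h"
    using A h adj_mat(1)[OF A] by simp
  also have "\<dots> = det A \<cdot>\<^sub>v h"
    using h by (subst adj_mat(2)[OF A], intro eq_vecI) (auto simp: smult_scalar_prod_distrib[of _ n])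
  finally show ?thesis
    using A h adj_mat(1)[OF A] det by (simp add: mult_mat_vec[OF A] smult_smult_assoc)
qed

text \<open>Only the existence of K matters: it is applied to an inverse matrix in
  \<open>nonsingular_psd_lower_bound\<close>. The summand 1 in the witness keeps K positive for a
  zero matrix.\<close>

lemma quadratic_form_upper_bound:
  fixes C :: "real mat"
  assumes C: "C \<in> carrier_mat n n"
  shows "\<exists>K>0. \<forall>u\<in>carrier_vec n. u \<bullet> (C *\<^sub>v u) \<le> K * (u \<bullet> u)"
proof (intro exI conjI ballI)
  let ?K = "1 + (\<Sum>j<n. \<Sum>k<n. \<bar>C $$ (j, k)\<bar>)"
  show "0 < ?K" by (intro add_pos_nonneg sum_nonneg) auto
  fix u :: "real Matrix.vec" assume u: "u \<in> carrier_vec n"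
  have uu: "u \<bullet> u = (\<Sum>j<n. (u $ j)\<^sup>2)"
    using u by (simp add: scalar_prod_def power2_eq_square atLeast0LessThan)
  have pos: "0 \<le> u \<bullet> u" by (simp add: uu sum_nonneg)
  have entry: "u $ j * (C $$ (j, k) * u $ k) \<le> \<bar>C $$ (j, k)\<bar> * (u \<bullet> u)" if "j < n" "k < n" for j k
  proof -
    have le: "(u $ i)\<^sup>2 \<le> u \<bullet> u" if "i < n" for i
      unfolding uu using that by (intro member_le_sum) auto
    have "2 * \<bar>u $ j * u $ k\<bar> \<le> (u $ j)\<^sup>2 + (u $ k)\<^sup>2"
      using zero_le_power2[of "\<bar>u $ j\<bar> - \<bar>u $ k\<bar>"] by (simp add: power2_eq_square algebra_simps abs_mult)
    then have "\<bar>u $ j * u $ k\<bar> \<le> u \<bullet> u" using le[OF that(1)] le[OF that(2)] by linarith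
    then have "\<bar>C $$ (j, k)\<bar> * \<bar>u $ j * u $ k\<bar> \<le> \<bar>C $$ (j, k)\<bar> * (u \<bullet> u)"
      by (intro mult_left_mono) auto
    moreover have "u $ j * (C $$ (j, k) * u $ k) \<le> \<bar>C $$ (j, k)\<bar> * \<bar>u $ j * u $ k\<bar>"
      by (rule order_trans[OF abs_ge_self]) (simp add: abs_mult mult_ac)
    ultimately show ?thesis by linarith
  qed
  have "u \<bullet> (C *\<^sub>v u) = (\<Sum>j<n. \<Sum>k<n. u $ j * (C $$ (j, k) * u $ k))"
    using u C by (simp add: scalar_prod_def sum_distrib_left atLeast0LessThan)
  also have "\<dots> \<le> (\<Sum>j<n. \<Sum>k<n. \<bar>C $$ (j, k)\<bar> * (u \<bullet> u))"
    by (intro sum_mono entry) auto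
  also have "\<dots> \<le> ?K * (u \<bullet> u)"
    using pos by (simp add: sum_distrib_right[symmetric] distrib_right)
  finally show "u \<bullet> (C *\<^sub>v u) \<le> ?K * (u \<bullet> u)" .
qed

text \<open>Evaluate the form of B at u - s v, where B v = u. By symmetry the value is u . B u - 2 s
  |u|^2 + s^2 u . v, and u . v \<le> K |u|^2 by the upper bound for the inverse matrix. The choice s
  = 1 / K leaves u . B u \<ge> |u|^2 / K.\<close>

lemma nonsingular_psd_lower_bound:
  fixes B :: "real mat"
  assumes B: "B \<in> carrier_mat n n" and sym: "B\<^sup>T = B" and det: "det B \<noteq> 0"
    and psd: "\<And>u. u \<in> carrier_vec n \<Longrightarrow> 0 \<le> u \<bullet> (B *\<^sub>v u)"
  shows "\<exists>\<delta>>0. \<forall>u\<in>carrier_vec n. \<delta> * (u \<bullet> u) \<le> u \<bullet> (B *\<^sub>v u)"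
proof -
  define C where "C = inverse (det B) \<cdot>\<^sub>m adj_mat B"
  have C: "C \<in> carrier_mat n n" using adj_mat(1)[OF B] by (simp add: C_def)
  have BC: "B *\<^sub>v (C *\<^sub>v u) = u" if u: "u \<in> carrier_vec n" for u
  proof -
    have "C *\<^sub>v u = inverse (det B) \<cdot>\<^sub>v (adj_mat B *\<^sub>v u)"
      using adj_mat(1)[OF B] u by (intro eq_vecI) (auto simp: C_def)
    then show ?thesis using mult_mat_vec_adj_solution[OF B det u] by simp
  qed
  obtain K where K: "0 < K" "\<And>u. u \<in> carrier_vec n \<Longrightarrow> u \<bullet> (C *\<^sub>v u) \<le> K * (u \<bullet> u)"
    using quadratic_form_upper_bound[OF C] by blast
  have "inverse K * (u \<bullet> u) \<le> u \<bullet> (B *\<^sub>v u)" if u: "u \<in> carrier_vec n" for u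
  proof -
    let ?s = "inverse K"
    define v where "v = C *\<^sub>v u"
    have v: "v \<in> carrier_vec n" using C u by (simp add: v_def)
    have Bv: "B *\<^sub>v v = u" using BC[OF u] by (simp add: v_def)
    have Bu: "B *\<^sub>v u \<in> carrier_vec n" using B u by simp
    have vBu: "v \<bullet> (B *\<^sub>v u) = u \<bullet> u"
      using transpose_vec_mult_scalar[OF B u v] by (simp add: sym Bv)
    have w: "u - ?s \<cdot>\<^sub>v v \<in> carrier_vec n" using u v by simp
    have "0 \<le> (u - ?s \<cdot>\<^sub>v v) \<bullet> (B *\<^sub>v (u - ?s \<cdot>\<^sub>v v))" by (rule psd[OF w])
    also have "B *\<^sub>v (u - ?s \<cdot>\<^sub>v v) = B *\<^sub>v u - ?s \<cdot>\<^sub>v u"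
      using u v by (simp add: mult_minus_distrib_mat_vec[OF B] mult_mat_vec[OF B] Bv)
    also have "(u - ?s \<cdot>\<^sub>v v) \<bullet> (B *\<^sub>v u - ?s \<cdot>\<^sub>v u)
        = u \<bullet> (B *\<^sub>v u) - 2 * ?s * (u \<bullet> u) + ?s\<^sup>2 * (u \<bullet> v)"
      using u v Bu by (simp add: minus_scalar_prod_distrib[of _ n] scalar_prod_minus_distrib[of _ n]
        vBu comm_scalar_prod[OF v u] power2_eq_square algebra_simps)
    also have "\<dots> \<le> u \<bullet> (B *\<^sub>v u) - 2 * ?s * (u \<bullet> u) + ?s\<^sup>2 * (K * (u \<bullet> u))"
      using K(2)[OF u] by (intro add_left_mono mult_left_mono) (auto simp: v_def)
    also have "\<dots> = u \<bullet> (B *\<^sub>v u) - ?s * (u \<bullet> u)"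
      using K(1) by (simp add: power2_eq_square)
    finally show ?thesis by simp
  qed
  then show ?thesis using K(1) by (intro exI[of _ "inverse K"]) auto
qed

text \<open>The largest \<open>t\<close> for which \<open>A - t I\<close> is positive semidefinite is an eigenvalue:
  otherwise \<open>A - t I\<close> would be positive definite and \<open>t\<close> could be increased. This replaces
  compactness of the sphere, since vectors of varying dimension carry no topology.\<close>

lemma lambda_min_less_imp_form_lower_bound:
  assumes cov: "covariance_matrix n A" and n: "0 < n" and l: "l < lambda_min A"
    and u: "u \<in> carrier_vec n"
  shows "l * (u \<bullet> u) \<le> u \<bullet> (A *\<^sub>v u)"
proof -
  have A: "A \<in> carrier_mat n n" and sym: "A\<^sup>T = A"
    and psd: "\<And>u. u \<in> carrier_vec n \<Longrightarrow> 0 \<le> u \<bullet> (A *\<^sub>v u)"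
    using cov by (auto simp: covariance_matrix_def)
  have uu0: "0 \<le> u \<bullet> u" for u :: "real Matrix.vec"
    by (simp add: scalar_prod_def sum_nonneg)
  define T where "T = {t. \<forall>u\<in>carrier_vec n. t * (u \<bullet> u) \<le> u \<bullet> (A *\<^sub>v u)}"
  have T0: "0 \<in> T" using psd by (auto simp: T_def)
  have "t \<le> unit_vec n 0 \<bullet> (A *\<^sub>v unit_vec n 0)" if "t \<in> T" for t
    using that[unfolded T_def] n by (auto dest!: bspec[of _ _ "unit_vec n 0"])
  then have bdd: "bdd_above T" by (auto simp: bdd_above_def)
  define t where "t = Sup T"
  \<comment> \<open>The supremum is attained: each u with u . u > 0 bounds every element of
    \<open>T\<close> by its Rayleigh quotient, hence also t.\<close>
  have tT: "t \<in> T" unfolding T_def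
  proof (clarify)
    fix u :: "real Matrix.vec" assume u: "u \<in> carrier_vec n"
    show "t * (u \<bullet> u) \<le> u \<bullet> (A *\<^sub>v u)"
    proof (cases "u \<bullet> u = 0")
      case True
      then show ?thesis using psd[OF u] by simp
    next
      case False
      then have p: "0 < u \<bullet> u" using uu0[of u] by simp
      have "T \<noteq> {}" using T0 by blast
      then have "t \<le> (u \<bullet> (A *\<^sub>v u)) / (u \<bullet> u)" unfolding t_def
        by (rule cSup_least) (use u p in \<open>auto simp: T_def pos_le_divide_eq\<close>)
      then show ?thesis using p by (simp add: pos_le_divide_eq)
    qed
  qed
  define B where "B = char_matrix A t"
  have B: "B \<in> carrier_mat n n" using A by (simp add: B_def)
  have Bu: "B *\<^sub>v u = A *\<^sub>v u - t \<cdot>\<^sub>v u" if "u \<in> carrier_vec n" for u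
    using that A by (intro eq_vecI) (auto simp: B_def char_matrix_def add_scalar_prod_distrib[of _ n])
  have quad: "u \<bullet> (B *\<^sub>v u) = u \<bullet> (A *\<^sub>v u) - t * (u \<bullet> u)" if "u \<in> carrier_vec n" for u
    using that A by (simp add: Bu scalar_prod_minus_distrib[of _ n])
  have symB: "B\<^sup>T = B"
  proof (rule eq_matI)
    fix i j assume ij: "i < dim_row B" "j < dim_col B"
    have "A $$ (j, i) = A $$ (i, j)" using arg_cong[OF sym, of "\<lambda>A. A $$ (i, j)"] ij A B by auto
    then show "B\<^sup>T $$ (i, j) = B $$ (i, j)" using ij A B by (auto simp: B_def char_matrix_def)
  qed (use B in auto)
  have "det B = 0"
  proof (rule ccontr)
    assume "det B \<noteq> 0"
    then obtain \<delta> where \<delta>: "0 < \<delta>" "\<And>u. u \<in> carrier_vec n \<Longrightarrow> \<delta> * (u \<bullet> u) \<le> u \<bullet> (B *\<^sub>v u)"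
      using nonsingular_psd_lower_bound[OF B symB] tT by (force simp: T_def quad)
    have "t + \<delta> \<in> T" using \<delta>(2) by (auto simp: T_def quad algebra_simps)
    from cSup_upper[OF this bdd] \<delta>(1) show False by (simp add: t_def)
  qed
  then have "t \<in> spectrum A" by (simp add: spectrum_def eigenvalue_det[OF A] B_def)
  then have "lambda_min A \<le> t"
    unfolding lambda_min_def by (intro Min_le card_finite_spectrum[OF A])
  then have "l * (u \<bullet> u) \<le> t * (u \<bullet> u)" using l uu0 by (intro mult_right_mono) auto
  also have "\<dots> \<le> u \<bullet> (A *\<^sub>v u)" using tT u by (auto simp: T_def)
  finally show ?thesis .
qed

section \<open>Orthonormal systems of a covariance form\<close>

definition bform :: "nat \<Rightarrow> real mat \<Rightarrow> (nat \<Rightarrow> real) \<Rightarrow> (nat \<Rightarrow> real) \<Rightarrow> real" where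
  "bform n A f g = (\<Sum>j<n. \<Sum>k<n. f j * A $$ (j, k) * g k)"

lemma scalar_prod_mult_mat_vec_eq_bform:
  assumes "A \<in> carrier_mat n n"
  shows "Matrix.vec n f \<bullet> (A *\<^sub>v Matrix.vec n g) = bform n A f g"
  using assms by (simp add: bform_def scalar_prod_def sum_distrib_left atLeast0LessThan mult.assoc)

lemma bform_cong:
  assumes "\<And>r. r < n \<Longrightarrow> f r = g r"
  shows "bform n A f f = bform n A g g"
  unfolding bform_def using assms by (intro sum.cong refl) auto

lemma bform_add_right: "bform n A f (\<lambda>r. g r + h r) = bform n A f g + bform n A f h"
  by (simp add: bform_def distrib_left sum.distrib)

lemma bform_diff_right: "bform n A f (\<lambda>r. g r - h r) = bform n A f g - bform n A f h"
  by (simp add: bform_def right_diff_distrib sum_subtractf)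

lemma bform_cmult_right: "bform n A f (\<lambda>r. c * g r) = c * bform n A f g"
  by (simp add: bform_def sum_distrib_left mult_ac)

lemma bform_sum_right:
  fixes m :: nat
  shows "bform n A f (\<lambda>r. \<Sum>i<m. g i r) = (\<Sum>i<m. bform n A f (g i))"
proof (induction m)
  case 0
  then show ?case by (simp add: bform_def)
next
  case (Suc m)
  then show ?case by (simp add: bform_add_right)
qed

lemma bform_commute:
  assumes "A \<in> carrier_mat n n" "A\<^sup>T = A"
  shows "bform n A f g = bform n A g f"
proof -
  have "A $$ (j, k) = A $$ (k, j)" if "j < n" "k < n" for j k
    using arg_cong[OF assms(2), of "\<lambda>A. A $$ (j, k)"] assms(1) that by auto
  then have "bform n A f g = (\<Sum>j<n. \<Sum>k<n. g k * A $$ (k, j) * f j)"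
    unfolding bform_def by (intro sum.cong refl) (auto simp: mult_ac)
  also have "\<dots> = bform n A g f" unfolding bform_def by (rule sum.swap)
  finally show ?thesis .
qed

lemma bform_orthonormal_combination:
  fixes m :: nat
  assumes "\<And>i j. i < m \<Longrightarrow> j < m \<Longrightarrow> bform n A (b i) (b j) = of_bool (i = j)"
    and "A \<in> carrier_mat n n" "A\<^sup>T = A"
  shows "bform n A (\<lambda>r. \<Sum>i<m. c i * b i r) (\<lambda>r. \<Sum>i<m. c i * b i r) = (\<Sum>i<m. (c i)\<^sup>2)"
proof -
  let ?f = "\<lambda>r. \<Sum>i<m. c i * b i r"
  have "bform n A ?f (b i) = c i" if "i < m" for i
  proof -
    have "bform n A ?f (b i) = (\<Sum>j<m. c j * bform n A (b i) (b j))"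
      by (subst bform_commute[OF assms(2,3)]) (simp add: bform_sum_right bform_cmult_right)
    also have "\<dots> = (\<Sum>j<m. if i = j then c j else 0)"
      using assms(1) that by (intro sum.cong) auto
    finally show ?thesis using that by simp
  qed
  then show ?thesis
    by (subst bform_sum_right) (simp add: bform_cmult_right power2_eq_square)
qed

text \<open>For a covariance form this is whitening: a combination of the \<open>b i\<close> with
  coefficients c has variance |c|^2. After k steps all functions vanishing from k on are spanned.
  When the remainder of the next unit function vanishes, the system is left as it is; this stands in
  for a proof of linear independence and gives m \<le> n, as much as the union bound over integer
  points asks for.\<close>

lemma gram_schmidt_bform:
  assumes A: "A \<in> carrier_mat n n" "A\<^sup>T = A"
    and pd: "\<And>f. \<exists>j<n. f j \<noteq> 0 \<Longrightarrow> 0 < bform n A f f"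
  obtains m b where "m \<le> n"
    and "\<And>i j. i < m \<Longrightarrow> j < m \<Longrightarrow> bform n A (b i) (b j) = of_bool (i = j)"
    and "\<And>f. \<exists>c. \<forall>r<n. f r = (\<Sum>i<m. c i * b i r)"
proof -
  have "k \<le> n \<Longrightarrow> \<exists>m b. m \<le> k \<and> (\<forall>i<m. \<forall>j<m. bform n A (b i) (b j) = of_bool (i = j)) \<and>
      (\<forall>f. (\<forall>r\<ge>k. f r = 0) \<longrightarrow> (\<exists>c. \<forall>r<n. f r = (\<Sum>i<m. c i * b i r)))" for k
  proof (induction k)
    case 0
    then show ?case by auto
  next
    case (Suc k)
    then obtain m b where m: "m \<le> k"
      and orth: "\<And>i j. i < m \<Longrightarrow> j < m \<Longrightarrow> bform n A (b i) (b j) = of_bool (i = j)"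
      and span: "\<And>f. \<forall>r\<ge>k. f r = 0 \<Longrightarrow> \<exists>c. \<forall>r<n. f r = (\<Sum>i<m. c i * b i r)"
      by auto
    define e :: "nat \<Rightarrow> real" where "e r = of_bool (r = k)" for r
    define \<gamma> where "\<gamma> i = bform n A e (b i)" for i
    define u where "u r = e r - (\<Sum>i<m. \<gamma> i * b i r)" for r
    have bu: "bform n A (b i) u = 0" if "i < m" for i
    proof -
      have "bform n A (b i) u = bform n A (b i) e - (\<Sum>j<m. \<gamma> j * bform n A (b i) (b j))"
        unfolding u_def[abs_def] by (simp add: bform_diff_right bform_sum_right bform_cmult_right)
      also have "(\<Sum>j<m. \<gamma> j * bform n A (b i) (b j)) = (\<Sum>j<m. if i = j then \<gamma> j else 0)"
        using orth that by (intro sum.cong) auto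
      finally show ?thesis using that by (simp add: \<gamma>_def bform_commute[OF A, of "b i" e])
    qed
    show ?case
    proof (cases "\<exists>r<n. u r \<noteq> 0")
      case False
      have "\<exists>c. \<forall>r<n. f r = (\<Sum>i<m. c i * b i r)" if f: "\<forall>r\<ge>Suc k. f r = 0" for f
      proof -
        have "\<forall>r\<ge>k. (f(k := 0)) r = 0" using f by (auto simp: le_Suc_eq)
        from span[OF this] obtain c where c: "\<And>r. r < n \<Longrightarrow> (f(k := 0)) r = (\<Sum>i<m. c i * b i r)"
          by blast
        have "f r = (\<Sum>i<m. (c i + f k * \<gamma> i) * b i r)" if r: "r < n" for r
        proof -
          have "f r = (f(k := 0)) r + f k * e r" by (simp add: e_def)
          also have "e r = (\<Sum>i<m. \<gamma> i * b i r)" using False r by (simp add: u_def)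
          finally show ?thesis unfolding c[OF r]
            by (simp add: distrib_right sum.distrib sum_distrib_left mult.assoc)
        qed
        then show ?thesis by (intro exI[of _ "\<lambda>i. c i + f k * \<gamma> i"]) auto
      qed
      then show ?thesis using m orth by (intro exI[of _ m] exI[of _ b]) auto
    next
      case True
      define N where "N = bform n A u u"
      have N: "0 < N" unfolding N_def by (rule pd[OF True])
      define b' where "b' = b(m := \<lambda>r. (1 / sqrt N) * u r)"
      have b'm: "b' m = (\<lambda>r. (1 / sqrt N) * u r)" and b'i: "\<And>i. i < m \<Longrightarrow> b' i = b i"
        by (auto simp: b'_def)
      have im: "bform n A (b i) (b' m) = 0" if "i < m" for i
        unfolding b'm bform_cmult_right using bu[OF that] by simp
      have "bform n A (b' m) (b' m) = (1 / sqrt N) * ((1 / sqrt N) * N)"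
        unfolding b'm N_def by (subst bform_cmult_right, subst bform_commute[OF A], subst bform_cmult_right) simp
      also have "\<dots> = 1" using N by (simp add: field_simps)
      finally have mm: "bform n A (b' m) (b' m) = 1" .
      have "bform n A (b' i) (b' j) = of_bool (i = j)" if "i < Suc m" "j < Suc m" for i j
        using that orth[of i j] im[of i] im[of j] mm bform_commute[OF A, of "b' m" "b j"]
        by (cases "i = m"; cases "j = m") (auto simp: b'i less_Suc_eq)
      moreover have "\<exists>c. \<forall>r<n. f r = (\<Sum>i<Suc m. c i * b' i r)" if f: "\<forall>r\<ge>Suc k. f r = 0" for f
      proof -
        have "\<forall>r\<ge>k. (f(k := 0)) r = 0" using f by (auto simp: le_Suc_eq)
        from span[OF this] obtain c where c: "\<And>r. r < n \<Longrightarrow> (f(k := 0)) r = (\<Sum>i<m. c i * b i r)"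
          by blast
        define c' where "c' = (\<lambda>i. if i = m then f k * sqrt N else c i + f k * \<gamma> i)"
        have "f r = (\<Sum>i<Suc m. c' i * b' i r)" if r: "r < n" for r
        proof -
          have "f r = (f(k := 0)) r + f k * e r" by (simp add: e_def)
          also have "e r = (\<Sum>i<m. \<gamma> i * b i r) + u r" by (simp add: u_def)
          finally have "f r = (\<Sum>i<m. (c i + f k * \<gamma> i) * b i r) + f k * u r" unfolding c[OF r]
            by (simp add: distrib_left distrib_right sum.distrib sum_distrib_left mult.assoc)
          also have "(\<Sum>i<m. (c i + f k * \<gamma> i) * b i r) = (\<Sum>i<m. c' i * b' i r)"
            by (intro sum.cong) (auto simp: c'_def b'i)
          also have "f k * u r = c' m * b' m r" using N by (simp add: c'_def b'm)
          finally show ?thesis by simp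
        qed
        then show ?thesis by (intro exI[of _ c']) auto
      qed
      ultimately show ?thesis using m by (intro exI[of _ "Suc m"] exI[of _ b']) auto
    qed
  qed
  from this[of n] obtain m b where "m \<le> n"
    and orth: "\<forall>i<m. \<forall>j<m. bform n A (b i) (b j) = of_bool (i = j)"
    and span: "\<And>f. \<forall>r\<ge>n. f r = 0 \<Longrightarrow> \<exists>c. \<forall>r<n. f r = (\<Sum>i<m. c i * b i r)" by auto
  show thesis
  proof (rule that[OF \<open>m \<le> n\<close>])
    show "\<exists>c. \<forall>r<n. f r = (\<Sum>i<m. c i * b i r)" for f
      using span[of "\<lambda>r. if r < n then f r else 0"] by fastforce
  qed (use orth in auto)
qed

section \<open>Independence of design and noise\<close>

lemma space_vec_borel: "space (vec_borel p) = carrier_vec p"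
  by (simp add: vec_borel_def)

lemma measurable_vec_borel_index:
  assumes "j < p"
  shows "(\<lambda>v. v $ j) \<in> borel_measurable (vec_borel p)"
proof -
  have "(\<lambda>v. (\<lambda>j\<in>{..<p}. v $ j) j) \<in> borel_measurable (vec_borel p)"
    unfolding vec_borel_def
    by (rule measurable_compose[OF measurable_vimage_algebra1 measurable_component_singleton])
       (use assms in \<open>auto simp: space_PiM split: if_splits\<close>)
  then show ?thesis using assms by simp
qed

lemma multivariate_normal_linear_form:
  assumes "multivariate_normal M p (0\<^sub>v p) A X"
  shows "distr M borel (\<lambda>\<omega>. \<Sum>j<p. f j * X \<omega> $ j) = normal_law 0 (bform p A f f)"
proof -
  have X: "X \<in> M \<rightarrow>\<^sub>M vec_borel p" and A: "A \<in> carrier_mat p p"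
    and law: "\<And>u. u \<in> carrier_vec p \<Longrightarrow>
      distr M borel (\<lambda>\<omega>. u \<bullet> X \<omega>) = normal_law (u \<bullet> 0\<^sub>v p) (u \<bullet> (A *\<^sub>v u))"
    using assms by (auto simp: multivariate_normal_def covariance_matrix_def)
  have "distr M borel (\<lambda>\<omega>. \<Sum>j<p. f j * X \<omega> $ j) = distr M borel (\<lambda>\<omega>. Matrix.vec p f \<bullet> X \<omega>)"
  proof (rule distr_cong)
    fix \<omega> assume "\<omega> \<in> space M"
    then have "X \<omega> \<in> carrier_vec p" using measurable_space[OF X] by (simp add: space_vec_borel)
    then show "(\<Sum>j<p. f j * X \<omega> $ j) = Matrix.vec p f \<bullet> X \<omega>"
      by (simp add: scalar_prod_def atLeast0LessThan)
  qed auto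
  then show ?thesis
    using law[of "Matrix.vec p f"] A by (simp add: scalar_prod_mult_mat_vec_eq_bform)
qed

section \<open>The sigma-algebra generated by the design\<close>

lemma measurable_ident_coarser:
  assumes "space N = space M" "sets N \<subseteq> sets M"
  shows "(\<lambda>\<omega>. \<omega>) \<in> M \<rightarrow>\<^sub>M N"
proof (rule measurableI)
  fix A assume "A \<in> sets N"
  then have "(\<lambda>\<omega>. \<omega>) -` A \<inter> space M = A" "A \<in> sets M"
    using assms sets.sets_into_space[of A N] by auto
  then show "(\<lambda>\<omega>. \<omega>) -` A \<inter> space M \<in> sets M" by simp
qed (simp add: assms)

text \<open>The design is represented by a coarser sigma-algebra on the sample space itself.
  Quantities computed from the design remain functions of \<omega>, and being determined by the
  design becomes measurability for this sigma-algebra.\<close>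

definition design_sigma ::
    "'a measure \<Rightarrow> nat \<Rightarrow> nat set \<Rightarrow> (nat \<Rightarrow> 'a \<Rightarrow> real Matrix.vec) \<Rightarrow> 'a measure" where
  "design_sigma M p I X = sigma (space M) (\<Union>i\<in>I. sets (vimage_algebra (space M) (X i) (vec_borel p)))"

lemma
  shows space_design_sigma: "space (design_sigma M p I X) = space M"
    and sets_design_sigma: "sets (design_sigma M p I X)
      = sigma_sets (space M) (\<Union>i\<in>I. sets (vimage_algebra (space M) (X i) (vec_borel p)))"
proof -
  have "(\<Union>i\<in>I. sets (vimage_algebra (space M) (X i) (vec_borel p))) \<subseteq> Pow (space M)"
    using sets.space_closed[of "vimage_algebra (space M) (X i) (vec_borel p)" for i] by auto
  then show "space (design_sigma M p I X) = space M" "sets (design_sigma M p I X)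
      = sigma_sets (space M) (\<Union>i\<in>I. sets (vimage_algebra (space M) (X i) (vec_borel p)))"
    by (simp_all add: design_sigma_def space_measure_of sets_measure_of)
qed

lemma sets_design_sigma_subset:
  assumes "\<And>i. i \<in> I \<Longrightarrow> X i \<in> M \<rightarrow>\<^sub>M vec_borel p"
  shows "sets (design_sigma M p I X) \<subseteq> sets M"
  unfolding sets_design_sigma
  using assms by (intro sets.sigma_sets_subset) (auto simp: measurable_iff_sets)

lemma measurable_design_sigma_index:
  assumes i: "i \<in> I" and X: "X i \<in> M \<rightarrow>\<^sub>M vec_borel p" and j: "j < p"
  shows "(\<lambda>\<omega>. X i \<omega> $ j) \<in> borel_measurable (design_sigma M p I X)"
proof -
  have "X i \<in> design_sigma M p I X \<rightarrow>\<^sub>M vec_borel p"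
    unfolding measurable_iff_sets space_design_sigma sets_design_sigma
    using measurable_space[OF X] i by (auto intro: sigma_sets.Basic)
  then show ?thesis by (rule measurable_compose[OF _ measurable_vec_borel_index[OF j]])
qed

context prob_space
begin

lemma indep_sets_reindex:
  assumes ind: "indep_sets F (h ` I)" and inj: "inj_on h I"
  shows "indep_sets (\<lambda>i. F (h i)) I"
proof (rule indep_setsI)
  show "F (h i) \<subseteq> events" if "i \<in> I" for i using ind that by (auto simp: indep_sets_def)
  fix A J assume J: "J \<noteq> {}" "J \<subseteq> I" "finite J" "\<forall>j\<in>J. A j \<in> F (h j)"
  let ?B = "\<lambda>k. A (inv_into I h k)"
  have inv: "inv_into I h (h j) = j" if "j \<in> J" for j using inj J(2) that by (auto intro: inv_into_f_f)
  have "prob (\<Inter>k\<in>h ` J. ?B k) = (\<Prod>k\<in>h ` J. prob (?B k))"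
    by (rule indep_setsD[OF ind]) (use J inv in auto)
  moreover have "(\<Inter>k\<in>h ` J. ?B k) = (\<Inter>j\<in>J. A j)" using inv by auto
  moreover have "(\<Prod>k\<in>h ` J. prob (?B k)) = (\<Prod>j\<in>J. prob (A j))"
    using inj_on_subset[OF inj J(2)] inv by (simp add: prod.reindex)
  ultimately show "prob (\<Inter>j\<in>J. A j) = (\<Prod>j\<in>J. prob (A j))" by simp
qed

lemma indep_vars_vimage_algebraI:
  assumes ind: "indep_sets (\<lambda>i. sets (vimage_algebra (space M) (X i) (N i))) I"
    and X: "\<And>i. i \<in> I \<Longrightarrow> X i \<in> space M \<rightarrow> space (N i)"
    and f: "\<And>i. i \<in> I \<Longrightarrow> f i \<in> N i \<rightarrow>\<^sub>M L i"
  shows "indep_vars L (\<lambda>i \<omega>. f i (X i \<omega>)) I"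
proof -
  have meas: "(\<lambda>\<omega>. f i (X i \<omega>)) \<in> vimage_algebra (space M) (X i) (N i) \<rightarrow>\<^sub>M L i" if "i \<in> I" for i
    by (rule measurable_compose[OF measurable_vimage_algebra1[OF X[OF that]] f[OF that]])
  have sub: "{(\<lambda>\<omega>. f i (X i \<omega>)) -` A \<inter> space M |A. A \<in> sets (L i)}
      \<subseteq> sets (vimage_algebra (space M) (X i) (N i))" if "i \<in> I" for i
    using measurable_sets[OF meas[OF that]] by auto
  have ev: "sets (vimage_algebra (space M) (X i) (N i)) \<subseteq> events" if "i \<in> I" for i
    using ind that by (auto simp: indep_sets_def)
  show ?thesis unfolding indep_vars_def2
  proof (intro conjI ballI)
    fix i assume i: "i \<in> I"
    show "random_variable (L i) (\<lambda>\<omega>. f i (X i \<omega>))"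
      using meas[OF i] ev[OF i] by (auto simp: measurable_def)
  next
    show "indep_sets (\<lambda>i. {(\<lambda>\<omega>. f i (X i \<omega>)) -` A \<inter> space M |A. A \<in> sets (L i)}) I"
      by (rule indep_sets_mono_sets[OF ind sub])
  qed
qed

lemma indep_design_linear_forms:
  assumes ind: "indep_design_noise M p I X Z"
    and X: "\<And>i. i \<in> I \<Longrightarrow> X i \<in> M \<rightarrow>\<^sub>M vec_borel p"
  shows "indep_vars (\<lambda>_. borel) (\<lambda>i \<omega>. \<Sum>j<p. f j * X i \<omega> $ j) I"
proof (rule indep_vars_vimage_algebraI[where f = "\<lambda>i v. \<Sum>j<p. f j * v $ j"])
  have "indep_sets (case_sum (\<lambda>i. sets (vimage_algebra (space M) (X i) (vec_borel p)))
      (\<lambda>i. sets (vimage_algebra (space M) (Z i) borel))) (Inl ` I)"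
    by (rule indep_sets_mono_index[OF _ ind[unfolded indep_design_noise_def]]) auto
  from indep_sets_reindex[OF this] show "indep_sets (\<lambda>i. sets (vimage_algebra (space M) (X i) (vec_borel p))) I"
    by simp
  show "X i \<in> space M \<rightarrow> space (vec_borel p)" if "i \<in> I" for i
    using measurable_space[OF X[OF that]] by auto
  show "(\<lambda>v. \<Sum>j<p. f j * v $ j) \<in> borel_measurable (vec_borel p)"
    by (intro borel_measurable_sum borel_measurable_times borel_measurable_const measurable_vec_borel_index) auto
qed

lemma indep_noise:
  assumes ind: "indep_design_noise M p I X Z"
  shows "indep_vars (\<lambda>_. borel) Z I"
proof (rule indep_vars_vimage_algebraI[where f = "\<lambda>i z. z"])
  have "indep_sets (case_sum (\<lambda>i. sets (vimage_algebra (space M) (X i) (vec_borel p)))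
      (\<lambda>i. sets (vimage_algebra (space M) (Z i) borel))) (Inr ` I)"
    by (rule indep_sets_mono_index[OF _ ind[unfolded indep_design_noise_def]]) auto
  from indep_sets_reindex[OF this] show "indep_sets (\<lambda>i. sets (vimage_algebra (space M) (Z i) borel)) I"
    by simp
qed auto

text \<open>The identity map, as a variable with values in the coarser space
  \<open>design_sigma\<close>, stands for the whole design. Independence of the two collected
  sigma-algebras gives the product law on rectangles, hence everywhere; integrating out the noise
  with the design fixed then becomes Fubini's theorem.\<close>

lemma joint_distr_design_noise:
  assumes ind: "indep_design_noise M p I X Z"
    and X: "\<And>i. i \<in> I \<Longrightarrow> X i \<in> M \<rightarrow>\<^sub>M vec_borel p"
    and Z: "\<And>i. i \<in> I \<Longrightarrow> Z i \<in> borel_measurable M"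
  shows "distr M (design_sigma M p I X) (\<lambda>\<omega>. \<omega>) \<Otimes>\<^sub>M distr M (\<Pi>\<^sub>M i\<in>I. borel) (\<lambda>\<omega>. \<lambda>i\<in>I. Z i \<omega>)
    = distr M (design_sigma M p I X \<Otimes>\<^sub>M (\<Pi>\<^sub>M i\<in>I. borel)) (\<lambda>\<omega>. (\<omega>, \<lambda>i\<in>I. Z i \<omega>))"
proof -
  let ?S = "design_sigma M p I X" and ?P = "\<Pi>\<^sub>M i\<in>I. (borel :: real measure)" and ?E = "\<lambda>\<omega>. \<lambda>i\<in>I. Z i \<omega>"
  let ?F = "case_sum (\<lambda>i. sets (vimage_algebra (space M) (X i) (vec_borel p)))
                     (\<lambda>i. sets (vimage_algebra (space M) (Z i) borel))"
  let ?J = "\<lambda>b. if b then Inl ` I else Inr ` I :: (nat + nat) set"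
  have "indep_sets (\<lambda>b. sigma_sets (space M) (\<Union>i\<in>?J b. ?F i)) UNIV"
  proof (rule indep_sets_collect_sigma)
    have "(\<Union>b\<in>UNIV. ?J b) = I <+> I" by (auto simp: UNIV_bool)
    then show "indep_sets ?F (\<Union>b\<in>UNIV. ?J b)" using ind by (simp add: indep_design_noise_def)
    show "Int_stable (?F i)" for i
      by (cases i) (auto intro: sets.Int_stable)
    show "disjoint_family_on ?J UNIV" by (auto simp: disjoint_family_on_def)
  qed
  moreover define S T where "S = sets (design_sigma M p I X)"
    and "T = sigma_sets (space M) (\<Union>i\<in>I. sets (vimage_algebra (space M) (Z i) borel))"
  moreover have "(\<lambda>b. sigma_sets (space M) (\<Union>i\<in>?J b. ?F i)) = case_bool S T"
    by (auto simp: S_def T_def sets_design_sigma fun_eq_iff split: bool.split)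
  ultimately have indST: "indep_set S T" unfolding indep_set_def by simp
  have sp: "(\<Union>i\<in>I. sets (vimage_algebra (space M) (Z i) borel)) \<subseteq> Pow (space M)"
    using sets.space_closed[of "vimage_algebra (space M) (Z i) borel" for i] by auto
  let ?N = "sigma (space M) (\<Union>i\<in>I. sets (vimage_algebra (space M) (Z i) borel))"
  have ZN: "(\<lambda>\<omega>. \<lambda>i\<in>I. Z i \<omega>) \<in> ?N \<rightarrow>\<^sub>M (\<Pi>\<^sub>M i\<in>I. borel)"
  proof (rule measurable_restrict)
    show "Z i \<in> borel_measurable ?N" if "i \<in> I" for i
      unfolding measurable_iff_sets using sp that by (auto intro: sigma_sets.Basic)
  qed
  have Tsets: "T = sets ?N" "space ?N = space M" using sp by (auto simp: T_def)
  have idm: "(\<lambda>\<omega>. \<omega>) \<in> M \<rightarrow>\<^sub>M ?S"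
    by (rule measurable_ident_coarser[OF space_design_sigma sets_design_sigma_subset[OF X]])
  have Em: "?E \<in> M \<rightarrow>\<^sub>M ?P" using Z by (rule measurable_restrict)
  interpret D: prob_space "distr M ?S (\<lambda>\<omega>. \<omega>)" by (rule prob_space_distr[OF idm])
  interpret PE: prob_space "distr M ?P ?E" by (rule prob_space_distr[OF Em])
  show ?thesis
  proof (rule pair_measure_eqI)
    show "sigma_finite_measure (distr M ?S (\<lambda>\<omega>. \<omega>))" "sigma_finite_measure (distr M ?P ?E)" ..
    show "sets (distr M ?S (\<lambda>\<omega>. \<omega>) \<Otimes>\<^sub>M distr M ?P ?E) = sets (distr M (?S \<Otimes>\<^sub>M ?P) (\<lambda>\<omega>. (\<omega>, ?E \<omega>)))"
      by (simp cong: sets_pair_measure_cong)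
    fix A B assume AB: "A \<in> sets (distr M ?S (\<lambda>\<omega>. \<omega>))" "B \<in> sets (distr M ?P ?E)"
    have A: "(\<lambda>\<omega>. \<omega>) -` A \<inter> space M = A" "A \<in> S"
      using AB(1) sets.sets_into_space[of A ?S] by (auto simp: S_def space_design_sigma)
    have B: "?E -` B \<inter> space M \<in> T"
      using measurable_sets[OF ZN, of B] AB(2) Tsets by simp
    have "emeasure (distr M ?S (\<lambda>\<omega>. \<omega>)) A * emeasure (distr M ?P ?E) B
        = emeasure M A * emeasure M (?E -` B \<inter> space M)"
      using AB A(1) by (simp add: emeasure_distr[OF idm] emeasure_distr[OF Em])
    also have "\<dots> = emeasure M (A \<inter> (?E -` B \<inter> space M))"
      using indep_setD[OF indST A(2) B] by (simp add: emeasure_eq_measure ennreal_mult)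
    also have "A \<inter> (?E -` B \<inter> space M) = (\<lambda>\<omega>. (\<omega>, ?E \<omega>)) -` (A \<times> B) \<inter> space M" by auto
    also have "emeasure M \<dots> = emeasure (distr M (?S \<Otimes>\<^sub>M ?P) (\<lambda>\<omega>. (\<omega>, ?E \<omega>))) (A \<times> B)"
      using AB by (intro emeasure_distr[symmetric] measurable_Pair[OF idm Em]) auto
    finally show "emeasure (distr M ?S (\<lambda>\<omega>. \<omega>)) A * emeasure (distr M ?P ?E) B
        = emeasure (distr M (?S \<Otimes>\<^sub>M ?P) (\<lambda>\<omega>. (\<omega>, ?E \<omega>))) (A \<times> B)" .
  qed
qed

text \<open>Conditionally on the design the weights \<open>w i\<close> are constants, so the weighted noise is
  sub-Gaussian with variance proxy \<open>s\<^sup>2 \<Sum> (w i)\<^sup>2\<close>.\<close>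

lemma random_weights_chernoff:
  assumes fin: "finite I"
    and N: "space N = space M" "sets N \<subseteq> sets M"
    and joint: "distr M N (\<lambda>\<omega>. \<omega>) \<Otimes>\<^sub>M distr M (\<Pi>\<^sub>M i\<in>I. borel) (\<lambda>\<omega>. \<lambda>i\<in>I. Z i \<omega>)
      = distr M (N \<Otimes>\<^sub>M (\<Pi>\<^sub>M i\<in>I. borel)) (\<lambda>\<omega>. (\<omega>, \<lambda>i\<in>I. Z i \<omega>))"
    and Z: "indep_vars (\<lambda>_. borel) Z I"
    and sub: "\<And>i. i \<in> I \<Longrightarrow> sub_gaussian M s (Z i)"
    and w: "\<And>i. i \<in> I \<Longrightarrow> w i \<in> borel_measurable N"
    and G: "G \<in> sets N"
    and V: "\<And>\<omega>. \<omega> \<in> G \<Longrightarrow> (\<Sum>i\<in>I. (w i \<omega>)\<^sup>2) \<le> V"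
    and \<theta>: "0 \<le> \<theta>"
  shows "prob {\<omega> \<in> G. b \<le> (\<Sum>i\<in>I. w i \<omega> * Z i \<omega>)} \<le> exp (s\<^sup>2 * \<theta>\<^sup>2 * V / 2 - \<theta> * b)"
proof -
  let ?P = "\<Pi>\<^sub>M i\<in>I. (borel :: real measure)"
  let ?E = "\<lambda>\<omega>. \<lambda>i\<in>I. Z i \<omega>"
  have idm: "(\<lambda>\<omega>. \<omega>) \<in> M \<rightarrow>\<^sub>M N"
    by (rule measurable_ident_coarser[OF N])
  have GM: "G \<in> sets M" using G N(2) by auto
  have Zm[measurable]: "Z i \<in> borel_measurable M" if "i \<in> I" for i
    using sub[OF that] by (simp add: sub_gaussian_def)
  have wM[measurable]: "w i \<in> borel_measurable M" if "i \<in> I" for i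
    using measurable_compose[OF idm w[OF that]] .
  note [measurable] = GM
  have Em: "?E \<in> M \<rightarrow>\<^sub>M ?P" using Zm by (rule measurable_restrict)
  \<comment> \<open>The indicator of \<open>G\<close> sits inside \<open>f\<close> so that the inner
    integral is bounded for every \<open>a\<close>: through \<open>V\<close> on \<open>G\<close>,
    and by 0 outside, where nothing limits the weights.\<close>
  define f where "f = (\<lambda>(a, e). ennreal (indicator G a * exp (\<theta> * (\<Sum>i\<in>I. w i a * e i))))"
  have fm: "f \<in> borel_measurable (N \<Otimes>\<^sub>M ?P)"
  proof -
    have [measurable]: "(\<lambda>x. w i (fst x)) \<in> borel_measurable (N \<Otimes>\<^sub>M ?P)" if "i \<in> I" for i
      by (rule measurable_compose[OF measurable_fst w[OF that]])
    have [measurable]: "(\<lambda>x. snd x i) \<in> borel_measurable (N \<Otimes>\<^sub>M ?P)" if "i \<in> I" for i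
      by (rule measurable_compose[OF measurable_snd measurable_component_singleton[OF that]])
    have [measurable]: "(\<lambda>x. indicator G (fst x) :: real) \<in> borel_measurable (N \<Otimes>\<^sub>M ?P)"
      by (rule measurable_compose[OF measurable_fst]) (use G in simp)
    show ?thesis unfolding f_def case_prod_beta by measurable
  qed
  interpret PE: prob_space "distr M ?P ?E" by (rule prob_space_distr[OF Em])
  have single: "(\<integral>\<^sup>+\<omega>. ennreal (exp (c * Z i \<omega>)) \<partial>M) \<le> ennreal (exp (s\<^sup>2 * c\<^sup>2 / 2))" if "i \<in> I" for c i
  proof -
    have "(\<integral>\<^sup>+\<omega>. ennreal (exp (c * Z i \<omega>)) \<partial>M) = ennreal (\<integral>\<omega>. exp (c * Z i \<omega>) \<partial>M)"
      using sub[OF that] by (intro nn_integral_eq_integral) (auto simp: sub_gaussian_def)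
    also have "\<dots> \<le> ennreal (exp (s\<^sup>2 * c\<^sup>2 / 2))"
      using sub[OF that] by (intro ennreal_leI) (auto simp: sub_gaussian_def)
    finally show ?thesis .
  qed
  have inner: "(\<integral>\<^sup>+e. f (a, e) \<partial>distr M ?P ?E) \<le> ennreal (exp (s\<^sup>2 * \<theta>\<^sup>2 * V / 2))"
    if a: "a \<in> space N" for a
  proof (cases "a \<in> G")
    case True
    have "(\<integral>\<^sup>+e. f (a, e) \<partial>distr M ?P ?E) = (\<integral>\<^sup>+\<omega>. f (a, ?E \<omega>) \<partial>M)"
      by (rule nn_integral_distr[OF Em]) (use fm a in measurable)
    also have "\<dots> = (\<integral>\<^sup>+\<omega>. (\<Prod>i\<in>I. ennreal (exp ((\<theta> * w i a) * Z i \<omega>))) \<partial>M)"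
      using True by (intro nn_integral_cong)
        (simp add: f_def prod_ennreal exp_sum[OF fin] sum_distrib_left mult.assoc)
    also have "\<dots> = (\<Prod>i\<in>I. \<integral>\<^sup>+\<omega>. ennreal (exp ((\<theta> * w i a) * Z i \<omega>)) \<partial>M)"
      by (intro indep_vars_nn_integral[OF fin] indep_vars_compose2[OF Z]) auto
    also have "\<dots> \<le> (\<Prod>i\<in>I. ennreal (exp (s\<^sup>2 * (\<theta> * w i a)\<^sup>2 / 2)))"
      by (intro prod_mono_ennreal) (use single in auto)
    also have "\<dots> = ennreal (exp (s\<^sup>2 * \<theta>\<^sup>2 * (\<Sum>i\<in>I. (w i a)\<^sup>2) / 2))"
      by (simp add: prod_ennreal exp_sum[OF fin, symmetric] sum_distrib_left sum_divide_distrib power_mult_distrib mult.assoc)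
    also have "\<dots> \<le> ennreal (exp (s\<^sup>2 * \<theta>\<^sup>2 * V / 2))"
      using V[OF True] by (auto intro!: ennreal_leI divide_right_mono mult_left_mono)
    finally show ?thesis .
  qed (simp add: f_def)
  have "(\<integral>\<^sup>+\<omega>. f (\<omega>, ?E \<omega>) * indicator (space M) \<omega> \<partial>M) = (\<integral>\<^sup>+\<omega>. f (\<omega>, ?E \<omega>) \<partial>M)"
    by (intro nn_integral_cong) simp
  also have "\<dots> = (\<integral>\<^sup>+x. f x \<partial>distr M (N \<Otimes>\<^sub>M ?P) (\<lambda>\<omega>. (\<omega>, ?E \<omega>)))"
    by (rule nn_integral_distr[symmetric, OF measurable_Pair[OF idm Em]]) (use fm in simp)
  also have "\<dots> = (\<integral>\<^sup>+a. \<integral>\<^sup>+e. f (a, e) \<partial>distr M ?P ?E \<partial>distr M N (\<lambda>\<omega>. \<omega>))"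
    unfolding joint[symmetric]
    by (rule PE.nn_integral_fst[symmetric]) (use fm in \<open>simp cong: measurable_cong_sets\<close>)
  also have "\<dots> \<le> (\<integral>\<^sup>+a. ennreal (exp (s\<^sup>2 * \<theta>\<^sup>2 * V / 2)) \<partial>distr M N (\<lambda>\<omega>. \<omega>))"
    by (rule nn_integral_mono) (use inner in simp)
  also have "\<dots> = ennreal (exp (s\<^sup>2 * \<theta>\<^sup>2 * V / 2))"
    using prob_space.emeasure_space_1[OF prob_space_distr[OF idm]] by simp
  finally have int: "(\<integral>\<^sup>+\<omega>. f (\<omega>, ?E \<omega>) * indicator (space M) \<omega> \<partial>M)
    \<le> ennreal (exp (s\<^sup>2 * \<theta>\<^sup>2 * V / 2))" .
  have "emeasure M {\<omega> \<in> G. b \<le> (\<Sum>i\<in>I. w i \<omega> * Z i \<omega>)}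
      \<le> emeasure M ({\<omega> \<in> space M. 1 \<le> ennreal (exp (- \<theta> * b)) * f (\<omega>, ?E \<omega>)} \<inter> space M)"
  proof (rule emeasure_mono)
    show "{\<omega> \<in> space M. 1 \<le> ennreal (exp (- \<theta> * b)) * f (\<omega>, ?E \<omega>)} \<inter> space M \<in> events"
      unfolding f_def by simp
    show "{\<omega> \<in> G. b \<le> (\<Sum>i\<in>I. w i \<omega> * Z i \<omega>)}
        \<subseteq> {\<omega> \<in> space M. 1 \<le> ennreal (exp (- \<theta> * b)) * f (\<omega>, ?E \<omega>)} \<inter> space M"
    proof clarify
      fix \<omega> assume \<omega>: "\<omega> \<in> G" "b \<le> (\<Sum>i\<in>I. w i \<omega> * Z i \<omega>)"
      then have "\<theta> * b \<le> \<theta> * (\<Sum>i\<in>I. w i \<omega> * Z i \<omega>)" using \<theta> by (intro mult_left_mono)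
      then show "\<omega> \<in> {\<omega> \<in> space M. 1 \<le> ennreal (exp (- \<theta> * b)) * f (\<omega>, ?E \<omega>)} \<inter> space M"
        using \<omega>(1) sets.sets_into_space[OF GM]
        by (auto simp: f_def ennreal_mult[symmetric] exp_add[symmetric])
    qed
  qed
  also have "\<dots> \<le> ennreal (exp (- \<theta> * b)) * (\<integral>\<^sup>+\<omega>. f (\<omega>, ?E \<omega>) * indicator (space M) \<omega> \<partial>M)"
    by (intro order_trans[OF _ nn_integral_Markov_inequality] emeasure_mono) (auto simp: f_def)
  also have "\<dots> \<le> ennreal (exp (- \<theta> * b)) * ennreal (exp (s\<^sup>2 * \<theta>\<^sup>2 * V / 2))"
    by (rule mult_left_mono[OF int]) simp
  also have "\<dots> = ennreal (exp (s\<^sup>2 * \<theta>\<^sup>2 * V / 2 - \<theta> * b))"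
    by (simp add: ennreal_mult[symmetric] exp_add[symmetric])
  finally show ?thesis
    unfolding emeasure_eq_measure by simp
qed

end

section \<open>The design event\<close>

text \<open>The event has to lie in \<open>design_sigma\<close>, since the noise is later integrated
  out with the design held on it. The constant 4800 is 8 times 600: each tail event then has
  probability at most exp (- 8 p), and there are at most exp (6 p) + p \<le> exp (7 p) of
  them.\<close>

lemma (in prob_space) gaussian_design_event:
  assumes n: "4800 * real p \<le> real (card I)" and p: "0 < p"
    and ind: "indep_design_noise M p I X Z"
    and X: "\<And>i. i \<in> I \<Longrightarrow> multivariate_normal M p (0\<^sub>v p) A (X i)"
    and l: "0 < l" "l < lambda_min A"
  obtains G where "G \<in> sets (design_sigma M p I X)" "prob (space M - G) \<le> exp (- real p)"
    "\<And>\<omega> u. \<omega> \<in> G \<Longrightarrow> 3 / 4 * real (card I) * l * (\<Sum>j<p. (u j)\<^sup>2)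
      \<le> (\<Sum>i\<in>I. (\<Sum>j<p. u j * X i \<omega> $ j)\<^sup>2)"
proof -
  let ?n = "real (card I)" and ?S = "design_sigma M p I X"
  have np: "0 < ?n" using n p by (intro less_le_trans[OF _ n]) simp
  \<comment> \<open>An infinite \<open>I\<close> has \<open>card I = 0\<close>, so the positive
    cardinality makes \<open>I\<close> finite as well as nonempty.\<close>
  then have fin: "finite I" and "I \<noteq> {}" by (auto simp: card_gt_0_iff)
  then obtain i\<^sub>0 where i\<^sub>0: "i\<^sub>0 \<in> I" by blast
  have Xm: "X i \<in> M \<rightarrow>\<^sub>M vec_borel p" if "i \<in> I" for i
    using X[OF that] by (simp add: multivariate_normal_def)
  have cov: "covariance_matrix p A" using X[OF i\<^sub>0] by (simp add: multivariate_normal_def)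
  then have A: "A \<in> carrier_mat p p" "A\<^sup>T = A" by (auto simp: covariance_matrix_def)
  have lower: "l * (\<Sum>j<p. (f j)\<^sup>2) \<le> bform p A f f" for f
    using lambda_min_less_imp_form_lower_bound[OF cov p l(2), of "Matrix.vec p f"]
      scalar_prod_mult_mat_vec_eq_bform[OF A(1), of f f]
    by (simp add: scalar_prod_def atLeast0LessThan power2_eq_square)
  have pd: "0 < bform p A f f" if "\<exists>j<p. f j \<noteq> 0" for f
  proof -
    from that obtain j where "j < p" "f j \<noteq> 0" by blast
    then have "0 < (\<Sum>j<p. (f j)\<^sup>2)" by (intro sum_pos2[of _ j]) auto
    then have "0 < l * (\<Sum>j<p. (f j)\<^sup>2)" using l by simp
    then show ?thesis using lower[of f] by linarith
  qed
  obtain m b where m: "m \<le> p"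
    and orth: "\<And>i j. i < m \<Longrightarrow> j < m \<Longrightarrow> bform p A (b i) (b j) = of_bool (i = j)"
    and span: "\<And>f. \<exists>c. \<forall>r<p. f r = (\<Sum>i<m. c i * b i r)"
    using gram_schmidt_bform[OF A pd] by blast
  define g where "g \<omega> i j = (\<Sum>r<p. b j r * X i \<omega> $ r)" for \<omega> i j
  have comb: "(\<Sum>j<m. c j * g \<omega> i j) = (\<Sum>r<p. (\<Sum>j<m. c j * b j r) * X i \<omega> $ r)" for c \<omega> i
    unfolding g_def sum_distrib_left sum_distrib_right
    by (subst sum.swap) (simp add: mult.assoc)
  have norm: "bform p A (\<lambda>r. \<Sum>j<m. c j * b j r) (\<lambda>r. \<Sum>j<m. c j * b j r) = (\<Sum>j<m. (c j)\<^sup>2)" for c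
    by (rule bform_orthonormal_combination[OF _ A]) (rule orth)
  \<comment> \<open>In the coordinates \<open>g\<close> the design is standard Gaussian: the
    variance of a linear form is |c|^2, whatever \<open>A\<close> is.\<close>
  have law: "distr M borel (\<lambda>\<omega>. \<Sum>j<m. c j * g \<omega> i j) = normal_law 0 (\<Sum>j<m. (c j)\<^sup>2)"
    if "i \<in> I" for c i
    unfolding comb multivariate_normal_linear_form[OF X[OF that]] norm ..
  have indg: "indep_vars (\<lambda>_. borel) (\<lambda>i \<omega>. \<Sum>j<m. c j * g \<omega> i j) I" for c
    unfolding comb by (rule indep_design_linear_forms[OF ind Xm])
  define Q where "Q c \<omega> = (\<Sum>i\<in>I. (\<Sum>j<m. c j * g \<omega> i j)\<^sup>2)" for c \<omega>
  have Qm: "Q c \<in> borel_measurable ?S" for c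
    unfolding Q_def[abs_def] g_def
    by (intro borel_measurable_sum borel_measurable_power borel_measurable_times borel_measurable_const
        measurable_design_sigma_index Xm) auto
  \<comment> \<open>At z = 0 both sides of the condition in \<open>L\<close> vanish, so
    \<open>L z\<close> would be the whole space. The bound wanted at that point is trivial and is
    treated apart.\<close>
  define Zs where "Zs = {z \<in> lattice_ball m. 0 < (\<Sum>j<m. (real_of_int (z j))\<^sup>2)}"
  define L where "L z = {\<omega> \<in> space M. Q (\<lambda>j. real_of_int (z j)) \<omega> \<le> 5 / 6 * ?n * (\<Sum>j<m. (real_of_int (z j))\<^sup>2)}" for z
  \<comment> \<open>Upper bounds are imposed on the m diagonal entries alone, because rounding one
    coordinate at a time involves no other curvature.\<close>
  define U where "U k = {\<omega> \<in> space M. 7 / 6 * ?n * 1 \<le> Q (\<lambda>j. of_bool (j = k)) \<omega>}" for k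
  have unit: "(\<Sum>j<m. (of_bool (j = k) :: real)\<^sup>2) = 1" if "k < m" for k
    using that by (subst sum.cong[OF refl, of _ _ "\<lambda>j. if j = k then 1 else 0"]) auto
  have Qunit: "Q (\<lambda>j. of_bool (j = k)) \<omega> = (\<Sum>i\<in>I. (g \<omega> i k)\<^sup>2)" if "k < m" for k \<omega>
  proof -
    have "(\<Sum>j<m. of_bool (j = k) * g \<omega> i j) = (\<Sum>j<m. if j = k then g \<omega> i j else 0)" for i
      by (intro sum.cong) auto
    then show ?thesis using that by (simp add: Q_def)
  qed
  have finZ: "finite Zs" by (simp add: Zs_def finite_lattice_ball)
  have LS: "L z \<in> sets ?S" for z
    unfolding L_def space_design_sigma[symmetric, of M p I X] using Qm by measurable
  have US: "U k \<in> sets ?S" for k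
    unfolding U_def space_design_sigma[symmetric, of M p I X] using Qm by measurable
  note sub = sets_design_sigma_subset[of I X M p, OF Xm]
  define Bad where "Bad = (\<Union>z\<in>Zs. L z) \<union> (\<Union>k<m. U k)"
  have BadS: "Bad \<in> sets ?S"
    unfolding Bad_def using finZ LS US by (intro sets.Un sets.finite_UN) auto
  have expn: "exp (- ?n / 600) \<le> exp (- 8 * real p)" using n by simp
  have probL: "prob (L z) \<le> exp (- 8 * real p)" if "z \<in> Zs" for z
  proof -
    have "0 < (\<Sum>j<m. (real_of_int (z j))\<^sup>2)" using that by (simp add: Zs_def)
    from gaussian_square_sum_lower_tail[OF indg fin law this]
    show ?thesis unfolding L_def Q_def using expn by linarith
  qed
  have probU: "prob (U k) \<le> exp (- 8 * real p)" if "k < m" for k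
  proof -
    have "prob {\<omega> \<in> space M. 7 / 6 * ?n * 1 \<le> (\<Sum>i\<in>I. (\<Sum>j<m. of_bool (j = k) * g \<omega> i j)\<^sup>2)}
        \<le> exp (- ?n / 600)"
    proof (rule gaussian_square_sum_upper_tail[OF indg fin])
      show "distr M borel (\<lambda>\<omega>. \<Sum>j<m. of_bool (j = k) * g \<omega> i j) = normal_law 0 1" if "i \<in> I" for i
        using law[OF that, of "\<lambda>j. of_bool (j = k)"] unfolding unit[OF \<open>k < m\<close>] .
    qed simp
    then show ?thesis unfolding U_def Q_def using expn by linarith
  qed
  have "prob Bad \<le> prob (\<Union>z\<in>Zs. L z) + prob (\<Union>k<m. U k)"
    unfolding Bad_def using finZ LS US sub by (intro measure_Un_le sets.finite_UN) auto
  also have "\<dots> \<le> (\<Sum>z\<in>Zs. prob (L z)) + (\<Sum>k<m. prob (U k))"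
    using finZ LS US sub by (intro add_mono finite_measure_subadditive_finite) auto
  also have "\<dots> \<le> (\<Sum>z\<in>Zs. exp (- 8 * real p)) + (\<Sum>k<m. exp (- 8 * real p))"
    by (intro add_mono sum_mono probL probU) auto
  also have "\<dots> = (real (card Zs) + real m) * exp (- 8 * real p)"
    by (simp add: distrib_right)
  also have "\<dots> \<le> exp (7 * real p) * exp (- 8 * real p)"
  proof (rule mult_right_mono)
    have "card Zs \<le> card (lattice_ball m)"
      by (rule card_mono[OF finite_lattice_ball]) (auto simp: Zs_def)
    then have "real (card Zs) \<le> exp (6 * real m)" using card_lattice_ball[of m] by linarith
    also have "\<dots> \<le> exp (6 * real p)" using m by simp
    finally have 1: "real (card Zs) \<le> exp (6 * real p)" .
    have "real m \<le> 6 * real p" using m by simp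
    also have "\<dots> \<le> exp (6 * real p)" using exp_ge_add_one_self[of "6 * real p"] by linarith
    finally have 2: "real m \<le> exp (6 * real p)" .
    have "2 \<le> exp (real p)" using exp_ge_add_one_self[of "real p"] p by linarith
    then have "2 * exp (6 * real p) \<le> exp (real p) * exp (6 * real p)" by (intro mult_right_mono) auto
    also have "\<dots> = exp (7 * real p)" by (simp add: exp_add[symmetric])
    finally show "real (card Zs) + real m \<le> exp (7 * real p)" using 1 2 by linarith
  qed simp
  also have "\<dots> = exp (- real p)" by (simp add: exp_add[symmetric])
  finally have probBad: "prob Bad \<le> exp (- real p)" .
  show thesis
  proof (rule that[of "space M - Bad"])
    show "space M - Bad \<in> sets ?S"
      using sets.compl_sets[OF BadS] by (simp add: space_design_sigma)
    have "Bad \<subseteq> space M" using sets.sets_into_space[OF BadS] by (simp add: space_design_sigma)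
    then show "prob (space M - (space M - Bad)) \<le> exp (- real p)"
      using probBad by (simp add: double_diff)
    fix \<omega> u assume \<omega>: "\<omega> \<in> space M - Bad"
    obtain c where c: "\<And>r. r < p \<Longrightarrow> u r = (\<Sum>i<m. c i * b i r)" using span[of u] by blast
    \<comment> \<open>The diagonal bound 7/6 is 5/6 + 1/3, so \<kappa> is \<open>?n / 3\<close> and
      the factor that remains is 5/6 - 1/12 = 3/4.\<close>
    have "(5 / 6 * ?n - (?n / 3) / 4) * (\<Sum>j<m. (c j)\<^sup>2) \<le> (\<Sum>i\<in>I. (\<Sum>j<m. c j * g \<omega> i j)\<^sup>2)"
    proof (rule quadratic_form_lower_bound_from_lattice)
      fix z assume z: "z \<in> lattice_ball m"
      show "5 / 6 * ?n * (\<Sum>j<m. (real_of_int (z j))\<^sup>2) \<le> (\<Sum>i\<in>I. (\<Sum>j<m. real_of_int (z j) * g \<omega> i j)\<^sup>2)"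
      proof (cases "0 < (\<Sum>j<m. (real_of_int (z j))\<^sup>2)")
        case True
        then have "\<omega> \<notin> L z" using z \<omega> by (auto simp: Bad_def Zs_def)
        then show ?thesis using \<omega> by (simp add: L_def Q_def)
      next
        case False
        then have "(\<Sum>j<m. (real_of_int (z j))\<^sup>2) = 0"
          using sum_nonneg[of "{..<m}" "\<lambda>j. (real_of_int (z j))\<^sup>2"] by fastforce
        then show ?thesis by (simp only: mult_zero_right) (simp add: sum_nonneg)
      qed
    next
      fix k assume k: "k < m"
      then have "\<omega> \<notin> U k" using \<omega> by (auto simp: Bad_def)
      then show "(\<Sum>i\<in>I. (g \<omega> i k)\<^sup>2) \<le> 5 / 6 * ?n + ?n / 3"
        using \<omega> by (simp add: U_def Qunit[OF k])
    qed simp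
    also have "(\<lambda>i. \<Sum>j<m. c j * g \<omega> i j) = (\<lambda>i. \<Sum>j<p. u j * X i \<omega> $ j)"
      unfolding comb using c by (intro ext sum.cong) auto
    also have "(\<Sum>j<m. (c j)\<^sup>2) = bform p A u u"
      unfolding norm[symmetric]
      by (rule bform_cong) (simp add: c)
    finally have "3 / 4 * ?n * bform p A u u \<le> (\<Sum>i\<in>I. (\<Sum>j<p. u j * X i \<omega> $ j)\<^sup>2)" by simp
    from order_trans[OF mult_left_mono[OF lower[of u], of "3 / 4 * ?n"] this]
    show "3 / 4 * ?n * l * (\<Sum>j<p. (u j)\<^sup>2) \<le> (\<Sum>i\<in>I. (\<Sum>j<p. u j * X i \<omega> $ j)\<^sup>2)"
      by (simp add: mult.assoc)
  qed
qed

section \<open>The least squares error\<close>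

lemma borel_measurable_det:
  fixes A :: "'a \<Rightarrow> real mat"
  assumes "\<And>\<omega>. A \<omega> \<in> carrier_mat n n"
    and "\<And>i j. i < n \<Longrightarrow> j < n \<Longrightarrow> (\<lambda>\<omega>. A \<omega> $$ (i, j)) \<in> borel_measurable N"
  shows "(\<lambda>\<omega>. det (A \<omega>)) \<in> borel_measurable N"
  unfolding det_def'[OF assms(1)]
proof (intro borel_measurable_sum borel_measurable_times borel_measurable_const borel_measurable_prod)
  fix q i assume "q \<in> {q. q permutes {0..<n}}" "i \<in> {0..<n}"
  then have "i < n" "q i < n" using permutes_in_image[of q "{0..<n}" i] by auto
  then show "(\<lambda>\<omega>. A \<omega> $$ (i, q i)) \<in> borel_measurable N" by (rule assms(2))
qed

lemma borel_measurable_adj_mat_index: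
  fixes A :: "'a \<Rightarrow> real mat"
  assumes A: "\<And>\<omega>. A \<omega> \<in> carrier_mat n n"
    and meas: "\<And>i j. i < n \<Longrightarrow> j < n \<Longrightarrow> (\<lambda>\<omega>. A \<omega> $$ (i, j)) \<in> borel_measurable N"
    and ij: "i < n" "j < n"
  shows "(\<lambda>\<omega>. adj_mat (A \<omega>) $$ (i, j)) \<in> borel_measurable N"
proof -
  have "(\<lambda>\<omega>. det (mat_delete (A \<omega>) j i)) \<in> borel_measurable N"
  proof (rule borel_measurable_det)
    show "mat_delete (A \<omega>) j i \<in> carrier_mat (n - 1) (n - 1)" for \<omega>
      using A[of \<omega>] by (simp add: mat_delete_def)
    fix k l assume kl: "k < n - 1" "l < n - 1"
    have "(\<lambda>\<omega>. mat_delete (A \<omega>) j i $$ (k, l))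
        = (\<lambda>\<omega>. A \<omega> $$ (if k < j then k else Suc k, if l < i then l else Suc l))"
      using carrier_matD[OF A] kl by (auto simp: mat_delete_def fun_eq_iff)
    also have "\<dots> \<in> borel_measurable N" using kl by (intro meas) auto
    finally show "(\<lambda>\<omega>. mat_delete (A \<omega>) j i $$ (k, l)) \<in> borel_measurable N" .
  qed
  moreover have "(\<lambda>\<omega>. adj_mat (A \<omega>) $$ (i, j)) = (\<lambda>\<omega>. (-1) ^ (j + i) * det (mat_delete (A \<omega>) j i))"
    using carrier_matD[OF A] ij by (auto simp: adj_mat_def cofactor_def fun_eq_iff)
  ultimately show ?thesis by simp
qed

text \<open>The weights are those of \<open>h\<^sup>T W\<^sup>-\<^sup>1 X\<^sup>T\<close>, with \<open>W = X\<^sup>T X\<close> inverted through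
  its adjugate, which makes them measurable functions of the design.\<close>

lemma least_squares_weights:
  fixes x :: "'i \<Rightarrow> 'a \<Rightarrow> real Matrix.vec"
  assumes fin: "finite I" and K: "0 < K"
    and x: "\<And>i j. i \<in> I \<Longrightarrow> j < p \<Longrightarrow> (\<lambda>\<omega>. x i \<omega> $ j) \<in> borel_measurable N"
    and lower: "\<And>\<omega> u. \<omega> \<in> G \<Longrightarrow> K * (\<Sum>j<p. (u j)\<^sup>2) \<le> (\<Sum>i\<in>I. (\<Sum>j<p. u j * x i \<omega> $ j)\<^sup>2)"
  obtains w where "\<And>i. i \<in> I \<Longrightarrow> w i \<in> borel_measurable N"
    and "\<And>\<omega>. \<omega> \<in> G \<Longrightarrow> (\<Sum>i\<in>I. (w i \<omega>)\<^sup>2) \<le> (\<Sum>j<p. (h j)\<^sup>2) / K"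
    and "\<And>\<omega> d e. \<omega> \<in> G \<Longrightarrow>
      (\<And>j. j < p \<Longrightarrow> (\<Sum>i\<in>I. x i \<omega> $ j * (\<Sum>k<p. x i \<omega> $ k * d k)) = (\<Sum>i\<in>I. x i \<omega> $ j * e i)) \<Longrightarrow>
      (\<Sum>j<p. h j * d j) = (\<Sum>i\<in>I. w i \<omega> * e i)"
proof -
  define W where "W \<omega> = Matrix.mat p p (\<lambda>(j, k). \<Sum>i\<in>I. x i \<omega> $ j * x i \<omega> $ k)" for \<omega>
  have W: "W \<omega> \<in> carrier_mat p p" for \<omega> by (simp add: W_def)
  have Wm: "(\<lambda>\<omega>. W \<omega> $$ (j, k)) \<in> borel_measurable N" if "j < p" "k < p" for j k
  proof -
    have "(\<lambda>\<omega>. \<Sum>i\<in>I. x i \<omega> $ j * x i \<omega> $ k) \<in> borel_measurable N"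
      using that x by (intro borel_measurable_sum borel_measurable_times) auto
    then show ?thesis using that by (simp add: W_def)
  qed
  \<comment> \<open>On \<open>G\<close> this is W^-1 h. Elsewhere the determinant may vanish; there
    \<open>inverse 0 = 0\<close> makes r zero, so the weights are total and measurable
    functions.\<close>
  define r where "r \<omega> j = inverse (det (W \<omega>)) * (\<Sum>k<p. adj_mat (W \<omega>) $$ (j, k) * h k)" for \<omega> j
  define w where "w i \<omega> = (\<Sum>j<p. x i \<omega> $ j * r \<omega> j)" for i \<omega>
  have form: "(\<Sum>j<p. u j * (\<Sum>k<p. W \<omega> $$ (j, k) * v k))
      = (\<Sum>i\<in>I. (\<Sum>j<p. u j * x i \<omega> $ j) * (\<Sum>k<p. x i \<omega> $ k * v k))" for u v \<omega>
  proof -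
    have "(\<Sum>j<p. u j * (\<Sum>k<p. W \<omega> $$ (j, k) * v k))
        = (\<Sum>j<p. \<Sum>k<p. \<Sum>i\<in>I. u j * x i \<omega> $ j * (x i \<omega> $ k * v k))"
      by (simp add: W_def sum_distrib_left sum_distrib_right mult_ac)
    also have "\<dots> = (\<Sum>j<p. \<Sum>i\<in>I. \<Sum>k<p. u j * x i \<omega> $ j * (x i \<omega> $ k * v k))"
      by (intro sum.cong refl sum.swap)
    also have "\<dots> = (\<Sum>i\<in>I. \<Sum>j<p. \<Sum>k<p. u j * x i \<omega> $ j * (x i \<omega> $ k * v k))"
      by (rule sum.swap)
    finally show ?thesis by (simp add: sum_product)
  qed
  have Wr: "(\<Sum>k<p. W \<omega> $$ (j, k) * r \<omega> k) = h j" if \<omega>: "\<omega> \<in> G" and j: "j < p" for \<omega> j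
  proof -
    have det: "det (W \<omega>) \<noteq> 0"
    proof
      assume "det (W \<omega>) = 0"
      then obtain v where v: "v \<in> carrier_vec p" "v \<noteq> 0\<^sub>v p" "W \<omega> *\<^sub>v v = 0\<^sub>v p"
        using det_0_iff_vec_prod_zero[OF W] by blast
      have z: "(\<Sum>k<p. W \<omega> $$ (j, k) * v $ k) = 0" if "j < p" for j
        using arg_cong[OF v(3), of "\<lambda>u. u $ j"] that v(1) W[of \<omega>]
        by (simp add: scalar_prod_def atLeast0LessThan)
      have "(\<Sum>i\<in>I. (\<Sum>j<p. v $ j * x i \<omega> $ j)\<^sup>2) = (\<Sum>j<p. v $ j * (\<Sum>k<p. W \<omega> $$ (j, k) * v $ k))"
        unfolding form by (simp add: power2_eq_square mult.commute)
      also have "\<dots> = 0" using z by simp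
      finally have "K * (\<Sum>j<p. (v $ j)\<^sup>2) \<le> 0" using lower[OF \<omega>, of "\<lambda>j. v $ j"] by simp
      then have "(\<Sum>j<p. (v $ j)\<^sup>2) \<le> 0" using K by (simp add: mult_le_0_iff)
      then have "(\<Sum>j<p. (v $ j)\<^sup>2) = 0" by (intro antisym sum_nonneg) auto
      then have "v = 0\<^sub>v p" using v(1) by (intro eq_vecI) (auto simp: sum_nonneg_eq_0_iff)
      then show False using v(2) by simp
    qed
    have "W \<omega> *\<^sub>v Matrix.vec p (r \<omega>) = Matrix.vec p h"
    proof -
      have "inverse (det (W \<omega>)) \<cdot>\<^sub>v (adj_mat (W \<omega>) *\<^sub>v Matrix.vec p h) = Matrix.vec p (r \<omega>)"
        using adj_mat(1)[OF W[of \<omega>]]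
        by (intro eq_vecI) (auto simp: r_def scalar_prod_def atLeast0LessThan)
      then show ?thesis using mult_mat_vec_adj_solution[OF W det, of "Matrix.vec p h"] by simp
    qed
    from arg_cong[OF this, of "\<lambda>u. u $ j"] show ?thesis
      using j W[of \<omega>] by (simp add: scalar_prod_def atLeast0LessThan)
  qed
  show thesis
  proof (rule that[of w])
    show "w i \<in> borel_measurable N" if "i \<in> I" for i
      unfolding w_def[abs_def] r_def using that
      by (intro borel_measurable_sum borel_measurable_times borel_measurable_const x
          borel_measurable_inverse borel_measurable_det[OF W Wm] borel_measurable_adj_mat_index[OF W Wm]) auto
  next
    fix \<omega> assume \<omega>: "\<omega> \<in> G"
    define R where "R = (\<Sum>j<p. (r \<omega> j)\<^sup>2)"
    define V where "V = (\<Sum>i\<in>I. (w i \<omega>)\<^sup>2)"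
    have "V = (\<Sum>j<p. r \<omega> j * (\<Sum>k<p. W \<omega> $$ (j, k) * r \<omega> k))"
      unfolding form by (simp add: V_def w_def power2_eq_square mult.commute)
    also have "\<dots> = (\<Sum>j<p. r \<omega> j * h j)" using Wr[OF \<omega>] by simp
    finally have V: "V = (\<Sum>j<p. r \<omega> j * h j)" .
    have KR: "K * R \<le> V"
      using lower[OF \<omega>, of "r \<omega>"] by (simp add: R_def V_def w_def mult.commute)
    \<comment> \<open>With R = |r|^2 one has 2 V = 2 r . h \<le> K R + |h|^2 / K, and K R \<le> V
      absorbs half of the left side. This is h . W^-1 h \<le> |h|^2 / K without diagonalising
      \<open>W\<close>.\<close>
    have "V * 2 = (\<Sum>j<p. 2 * (r \<omega> j * h j))" unfolding V by (simp add: sum_distrib_left mult.commute)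
    also have "\<dots> \<le> (\<Sum>j<p. K * (r \<omega> j)\<^sup>2 + (h j)\<^sup>2 / K)"
    proof (rule sum_mono)
      fix j
      have "0 \<le> (K * r \<omega> j - h j)\<^sup>2 / K" using K by simp
      also have "\<dots> = K * (r \<omega> j)\<^sup>2 + (h j)\<^sup>2 / K - 2 * (r \<omega> j * h j)"
        using K by (simp add: power2_eq_square field_simps)
      finally show "2 * (r \<omega> j * h j) \<le> K * (r \<omega> j)\<^sup>2 + (h j)\<^sup>2 / K" by simp
    qed
    also have "\<dots> = K * R + (\<Sum>j<p. (h j)\<^sup>2) / K"
      by (simp add: sum.distrib R_def sum_distrib_left sum_divide_distrib)
    finally show "(\<Sum>i\<in>I. (w i \<omega>)\<^sup>2) \<le> (\<Sum>j<p. (h j)\<^sup>2) / K" using KR by (simp add: V_def)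
  next
    fix \<omega> d e assume \<omega>: "\<omega> \<in> G"
      and eq: "\<And>j. j < p \<Longrightarrow> (\<Sum>i\<in>I. x i \<omega> $ j * (\<Sum>k<p. x i \<omega> $ k * d k)) = (\<Sum>i\<in>I. x i \<omega> $ j * e i)"
    have swap: "(\<Sum>i\<in>I. (\<Sum>j<p. r \<omega> j * x i \<omega> $ j) * c i) = (\<Sum>j<p. r \<omega> j * (\<Sum>i\<in>I. x i \<omega> $ j * c i))" for c
      by (simp only: sum_distrib_left sum_distrib_right mult.assoc) (rule sum.swap)
    have "(\<Sum>j<p. h j * d j) = (\<Sum>j<p. d j * (\<Sum>k<p. W \<omega> $$ (j, k) * r \<omega> k))"
      using Wr[OF \<omega>] by (simp add: mult.commute)
    also have "\<dots> = (\<Sum>i\<in>I. (\<Sum>j<p. r \<omega> j * x i \<omega> $ j) * (\<Sum>k<p. x i \<omega> $ k * d k))"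
      unfolding form by (simp add: mult.commute)
    also have "\<dots> = (\<Sum>j<p. r \<omega> j * (\<Sum>i\<in>I. x i \<omega> $ j * (\<Sum>k<p. x i \<omega> $ k * d k)))"
      by (rule swap)
    also have "\<dots> = (\<Sum>j<p. r \<omega> j * (\<Sum>i\<in>I. x i \<omega> $ j * e i))" using eq by simp
    also have "\<dots> = (\<Sum>i\<in>I. w i \<omega> * e i)"
      unfolding swap[symmetric] w_def by (simp add: mult.commute)
    finally show "(\<Sum>j<p. h j * d j) = (\<Sum>i\<in>I. w i \<omega> * e i)" .
  qed
qed

text \<open>An arbitrary linear form h of the error, rather than one coordinate, lets two
  coordinates be compared at the price |h|^2 = 2. On \<open>G\<close> the normal equations determine
  \<open>d\<close>, and the event becomes one about weighted noise.\<close>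

lemma (in prob_space) least_squares_error_tail:
  assumes fin: "finite I" and K: "0 < K"
    and ind: "indep_design_noise M p I X Z"
    and X: "\<And>i. i \<in> I \<Longrightarrow> X i \<in> M \<rightarrow>\<^sub>M vec_borel p"
    and sub: "\<And>i. i \<in> I \<Longrightarrow> sub_gaussian M s (Z i)"
    and G: "G \<in> sets (design_sigma M p I X)"
    and lower: "\<And>\<omega> u. \<omega> \<in> G \<Longrightarrow> K * (\<Sum>j<p. (u j)\<^sup>2) \<le> (\<Sum>i\<in>I. (\<Sum>j<p. u j * X i \<omega> $ j)\<^sup>2)"
    and normal_eq: "\<And>\<omega> j. \<omega> \<in> G \<Longrightarrow> j < p \<Longrightarrow>
      (\<Sum>i\<in>I. X i \<omega> $ j * (\<Sum>k<p. X i \<omega> $ k * d \<omega> k)) = (\<Sum>i\<in>I. X i \<omega> $ j * Z i \<omega>)"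
    and \<theta>: "0 \<le> \<theta>"
  shows "prob {\<omega> \<in> G. b \<le> (\<Sum>j<p. h j * d \<omega> j)} \<le> exp (s\<^sup>2 * \<theta>\<^sup>2 * ((\<Sum>j<p. (h j)\<^sup>2) / K) / 2 - \<theta> * b)"
proof -
  let ?S = "design_sigma M p I X"
  have "(\<lambda>\<omega>. X i \<omega> $ j) \<in> borel_measurable ?S" if "i \<in> I" "j < p" for i j
    using that by (intro measurable_design_sigma_index X)
  from least_squares_weights[where x = X and h = h, OF fin K this lower] obtain w
    where w: "\<And>i. i \<in> I \<Longrightarrow> w i \<in> borel_measurable ?S"
      "\<And>\<omega>. \<omega> \<in> G \<Longrightarrow> (\<Sum>i\<in>I. (w i \<omega>)\<^sup>2) \<le> (\<Sum>j<p. (h j)\<^sup>2) / K"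
      and eq: "\<And>\<omega> d e. \<omega> \<in> G \<Longrightarrow>
      (\<And>j. j < p \<Longrightarrow> (\<Sum>i\<in>I. X i \<omega> $ j * (\<Sum>k<p. X i \<omega> $ k * d k)) = (\<Sum>i\<in>I. X i \<omega> $ j * e i)) \<Longrightarrow>
      (\<Sum>j<p. h j * d j) = (\<Sum>i\<in>I. w i \<omega> * e i)" by blast
  have "(\<Sum>j<p. h j * d \<omega> j) = (\<Sum>i\<in>I. w i \<omega> * Z i \<omega>)" if "\<omega> \<in> G" for \<omega>
    using that by (intro eq normal_eq)
  then have "{\<omega> \<in> G. b \<le> (\<Sum>j<p. h j * d \<omega> j)} = {\<omega> \<in> G. b \<le> (\<Sum>i\<in>I. w i \<omega> * Z i \<omega>)}" by auto
  moreover have "Z i \<in> borel_measurable M" if "i \<in> I" for i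
    using sub[OF that] by (simp add: sub_gaussian_def)
  ultimately show ?thesis
    using random_weights_chernoff[OF fin space_design_sigma sets_design_sigma_subset[OF X]
        joint_distr_design_noise[OF ind X] indep_noise[OF ind] sub w(1) G w(2) \<theta>] by simp
qed

section \<open>Support recovery\<close>

lemma OLS_error_normal_equations:
  assumes ols: "is_OLS n p x y b" and n: "0 < n" and j: "j < p"
    and x: "\<And>i. i \<in> {1..n} \<Longrightarrow> x i \<in> carrier_vec p" and \<beta>: "\<beta> \<in> carrier_vec p"
    and y: "\<And>i. i \<in> {1..n} \<Longrightarrow> y i = x i \<bullet> \<beta> + e i"
  shows "(\<Sum>i\<in>{1..n}. x i $ j * (\<Sum>k<p. x i $ k * (b $ k - \<beta> $ k))) = (\<Sum>i\<in>{1..n}. x i $ j * e i)"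
proof -
  have b: "b \<in> carrier_vec p" and eq: "S_xx n p x *\<^sub>v b = S_xy n p x y"
    using ols by (auto simp: is_OLS_def)
  have "(\<Sum>k<p. (1 / real n * (\<Sum>i=1..n. x i $ j * x i $ k)) * b $ k) = 1 / real n * (\<Sum>i=1..n. y i * x i $ j)"
    using arg_cong[OF eq, of "\<lambda>u. u $ j"] j b
    by (simp add: S_xx_def S_xy_def scalar_prod_def atLeast0LessThan)
  then have "1 / real n * (\<Sum>k<p. (\<Sum>i=1..n. x i $ j * x i $ k) * b $ k) = 1 / real n * (\<Sum>i=1..n. y i * x i $ j)"
    by (simp only: sum_distrib_left[of "1 / real n" "\<lambda>k. (\<Sum>i=1..n. x i $ j * x i $ k) * b $ k"]
        mult.assoc[symmetric])
  then have "(\<Sum>k<p. (\<Sum>i=1..n. x i $ j * x i $ k) * b $ k) = (\<Sum>i=1..n. y i * x i $ j)"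
    using n by simp
  also have "(\<Sum>k<p. (\<Sum>i=1..n. x i $ j * x i $ k) * b $ k) = (\<Sum>i=1..n. x i $ j * (\<Sum>k<p. x i $ k * b $ k))"
    by (simp only: sum_distrib_left sum_distrib_right mult.assoc) (rule sum.swap)
  also have "(\<Sum>i=1..n. y i * x i $ j)
      = (\<Sum>i=1..n. x i $ j * (\<Sum>k<p. x i $ k * \<beta> $ k)) + (\<Sum>i=1..n. x i $ j * e i)"
    unfolding sum.distrib[symmetric]
  proof (intro sum.cong refl)
    fix i assume i: "i \<in> {1..n}"
    have "x i \<bullet> \<beta> = (\<Sum>k<p. x i $ k * \<beta> $ k)"
      using \<beta> by (simp add: scalar_prod_def atLeast0LessThan)
    then show "y i * x i $ j = x i $ j * (\<Sum>k<p. x i $ k * \<beta> $ k) + x i $ j * e i"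
      by (simp add: y[OF i] algebra_simps)
  qed
  finally show ?thesis
    by (simp add: right_diff_distrib sum_subtractf)
qed

text \<open>Each pair \<open>i \<in> S, j \<notin> S\<close> is handled through the single linear form \<open>\<plusminus>d i \<plusminus> d j\<close>, whose
  variance proxy is only twice that of one coordinate. Bounding every coordinate separately by half
  the signal would lose the constant, because the smallest eigenvalue of \<open>S_xx\<close> falls short of
  \<open>lambda_min\<close> by a factor.\<close>

lemma not_top_index_set_imp_large_contrast:
  fixes b \<beta> :: "real Matrix.vec"
  assumes b: "b \<in> carrier_vec p" and \<beta>: "\<beta> \<in> carrier_vec p"
    and not_top: "\<not> is_top_index_set (card (supp_vec \<beta>)) (map_vec abs b) (supp_vec \<beta>)"
  shows "\<exists>i\<in>supp_vec \<beta>. \<exists>j\<in>{..<p} - supp_vec \<beta>. \<exists>s\<in>{1, -1}.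
    \<bar>\<beta> $ i\<bar> \<le> - sgn (\<beta> $ i) * (b $ i - \<beta> $ i) + s * (b $ j - \<beta> $ j)"
proof -
  have S: "supp_vec \<beta> \<subseteq> {..<p}" using \<beta> by (auto simp: supp_vec_def)
  \<comment> \<open>The support has the right size and range, so only a comparison can fail. Top
    sets are strict, so failure includes the tie |b i| = |b j|.\<close>
  obtain i j where ij: "i \<in> supp_vec \<beta>" "j \<in> {..<p} - supp_vec \<beta>" "\<bar>b $ i\<bar> \<le> \<bar>b $ j\<bar>"
    using not_top S b unfolding is_top_index_set_def by (force simp: not_less)
  have bj: "\<beta> $ j = 0" using ij(2) \<beta> by (auto simp: supp_vec_def)
  define s :: real where "s = (if 0 \<le> b $ j then 1 else - 1)"
  have "s * (b $ j - \<beta> $ j) = \<bar>b $ j\<bar>" by (simp add: s_def bj)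
  moreover have "- sgn (\<beta> $ i) * (b $ i - \<beta> $ i) = \<bar>\<beta> $ i\<bar> - sgn (\<beta> $ i) * b $ i"
    by (simp add: algebra_simps abs_sgn)
  moreover have "sgn (\<beta> $ i) * b $ i \<le> \<bar>b $ i\<bar>"
    by (auto simp: sgn_if)
  ultimately have "\<bar>\<beta> $ i\<bar> \<le> - sgn (\<beta> $ i) * (b $ i - \<beta> $ i) + s * (b $ j - \<beta> $ j)"
    using ij(3) by linarith
  moreover have "s \<in> {1, -1}" by (simp add: s_def)
  ultimately show ?thesis using ij by blast
qed

lemma (in prob_space) top_index_set_probability:
  assumes n: "4800 * real p \<le> real n" and p: "0 < p"
    and \<beta>: "\<beta> \<in> carrier_vec p"
    and design: "\<And>i. i \<in> {1..n} \<Longrightarrow> multivariate_normal M p (0\<^sub>v p) A (x i)"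
    and noise: "\<And>i. i \<in> {1..n} \<Longrightarrow> sub_gaussian M \<sigma> (e i)"
    and indep: "indep_design_noise M p {1..n} x e"
    and model: "\<And>i \<omega>. i \<in> {1..n} \<Longrightarrow> \<omega> \<in> space M \<Longrightarrow> y i \<omega> = x i \<omega> \<bullet> \<beta> + e i \<omega>"
    and bm: "b \<in> M \<rightarrow>\<^sub>M vec_borel p"
    and ols: "\<And>\<omega>. \<omega> \<in> space M \<Longrightarrow> is_OLS n p (\<lambda>i. x i \<omega>) (\<lambda>i. y i \<omega>) (b \<omega>)"
    and \<sigma>: "0 \<le> \<sigma>" and q: "0 \<le> q" and l: "0 < l" "l < lambda_min A"
    and signal: "\<And>j. j \<in> supp_vec \<beta> \<Longrightarrow> 4 * \<sigma> * sqrt (q / (real n * l)) < \<bar>\<beta> $ j\<bar>"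
  shows "1 - exp (- real p) - 2 * (real p)\<^sup>2 * exp (- 3 * q)
    \<le> prob {\<omega> \<in> space M. is_top_index_set (card (supp_vec \<beta>)) (map_vec abs (b \<omega>)) (supp_vec \<beta>)}"
proof -
  let ?S = "supp_vec \<beta>"
  define T where "T = {\<omega> \<in> space M. is_top_index_set (card ?S) (map_vec abs (b \<omega>)) ?S}"
  have n0: "0 < n" using n p by (cases n) auto
  have S: "?S \<subseteq> {..<p}" using \<beta> by (auto simp: supp_vec_def)
  then have finS: "finite ?S" by (rule finite_subset) simp
  have X: "x i \<in> M \<rightarrow>\<^sub>M vec_borel p" if "i \<in> {1..n}" for i
    using design[OF that] by (simp add: multivariate_normal_def)
  have Xc: "x i \<omega> \<in> carrier_vec p" if "i \<in> {1..n}" "\<omega> \<in> space M" for i \<omega>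
    using measurable_space[OF X[OF that(1)] that(2)] by (simp add: space_vec_borel)
  have bc: "b \<omega> \<in> carrier_vec p" if "\<omega> \<in> space M" for \<omega>
    using measurable_space[OF bm that] by (simp add: space_vec_borel)
  have bj[measurable]: "(\<lambda>\<omega>. b \<omega> $ j) \<in> borel_measurable M" if "j < p" for j
    using measurable_compose[OF bm measurable_vec_borel_index[OF that]] .
  obtain G where G: "G \<in> sets (design_sigma M p {1..n} x)" "prob (space M - G) \<le> exp (- real p)"
    and lower: "\<And>\<omega> u. \<omega> \<in> G \<Longrightarrow> 3 / 4 * real n * l * (\<Sum>j<p. (u j)\<^sup>2)
      \<le> (\<Sum>i\<in>{1..n}. (\<Sum>j<p. u j * x i \<omega> $ j)\<^sup>2)"
    using gaussian_design_event[of p "{1..n}" x e A l] n p indep design l by auto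
  have GM: "G \<in> events" using G(1) sets_design_sigma_subset[of "{1..n}" x M p, OF X] by auto
  then have Gsp: "G \<subseteq> space M" by (rule sets.sets_into_space)
  define d where "d \<omega> j = b \<omega> $ j - \<beta> $ j" for \<omega> j
  have K: "0 < 3 / 4 * real n * l" using n0 l by simp
  have normal_eq: "(\<Sum>i\<in>{1..n}. x i \<omega> $ j * (\<Sum>k<p. x i \<omega> $ k * d \<omega> k)) = (\<Sum>i\<in>{1..n}. x i \<omega> $ j * e i \<omega>)"
    if "\<omega> \<in> G" "j < p" for \<omega> j
    unfolding d_def using that Gsp
    by (intro OLS_error_normal_equations[OF ols n0 _ Xc \<beta> model]) auto
  \<comment> \<open>The sign at i is dictated by \<beta> i and only the sign at j is free, hence 2
    p^2 events instead of 4 p^2.\<close>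
  define Bad where "Bad = (\<lambda>(i, j, s). {\<omega> \<in> G. \<bar>\<beta> $ i\<bar> \<le> - sgn (\<beta> $ i) * d \<omega> i + s * d \<omega> j})"
  define J where "J = ?S \<times> ({..<p} - ?S) \<times> {1, - 1 :: real}"
  have finJ: "finite J" using finS by (simp add: J_def)
  have cardJ: "real (card J) \<le> 2 * (real p)\<^sup>2"
  proof -
    have "card J \<le> card ({..<p} \<times> {..<p} \<times> {1, - 1 :: real})"
      using S by (intro card_mono) (auto simp: J_def)
    also have "\<dots> = 2 * p\<^sup>2" by (simp add: card_cartesian_product power2_eq_square)
    finally have "real (card J) \<le> real (2 * p\<^sup>2)" by (rule of_nat_mono)
    then show ?thesis by simp
  qed
  have BadM: "Bad t \<in> events" if "t \<in> J" for t
  proof -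
    obtain i j s where t: "t = (i, j, s)" by (cases t)
    have [measurable]: "(\<lambda>\<omega>. b \<omega> $ i) \<in> borel_measurable M" "(\<lambda>\<omega>. b \<omega> $ j) \<in> borel_measurable M"
      using that S by (auto simp: t J_def intro!: bj)
    have "Bad t = G \<inter> {\<omega> \<in> space M. \<bar>\<beta> $ i\<bar> \<le> - sgn (\<beta> $ i) * d \<omega> i + s * d \<omega> j}"
      using Gsp by (auto simp: Bad_def t)
    also have "\<dots> \<in> events" unfolding d_def by (rule sets.Int[OF GM]) measurable
    finally show ?thesis .
  qed
  have Badp: "prob (Bad t) \<le> exp (- 3 * q)" if t: "t \<in> J" for t
  proof -
    obtain i j s where tt: "t = (i, j, s)" by (cases t)
    have ij: "i \<in> ?S" "i < p" "j < p" "i \<noteq> j" "s\<^sup>2 = 1" and \<beta>i: "\<beta> $ i \<noteq> 0"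
      using t S by (auto simp: tt J_def supp_vec_def)
    define h where "h k = - sgn (\<beta> $ i) * of_bool (k = i) + s * of_bool (k = j)" for k
    have hd: "(\<Sum>k<p. h k * d \<omega> k) = - sgn (\<beta> $ i) * d \<omega> i + s * d \<omega> j" for \<omega>
    proof -
      have "(\<Sum>k<p. h k * d \<omega> k)
          = (\<Sum>k<p. (if k = i then - sgn (\<beta> $ i) * d \<omega> i else 0) + (if k = j then s * d \<omega> j else 0))"
        using ij by (intro sum.cong) (auto simp: h_def)
      then show ?thesis using ij by (simp add: sum.distrib)
    qed
    have h2: "(\<Sum>k<p. (h k)\<^sup>2) = 2"
    proof -
      have "(\<Sum>k<p. (h k)\<^sup>2) = (\<Sum>k<p. (if k = i then 1 else 0) + (if k = j then 1 else 0))"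
        using ij \<beta>i by (intro sum.cong) (auto simp: h_def sgn_if)
      then show ?thesis using ij by (simp add: sum.distrib)
    qed
    define a where "a = \<bar>\<beta> $ i\<bar>"
    have a: "0 < a" using \<beta>i by (simp add: a_def)
    have nl: "0 < real n * l" using n0 l by simp
    have "(4 * \<sigma> * sqrt (q / (real n * l)))\<^sup>2 \<le> a\<^sup>2"
      using signal[OF ij(1)] \<sigma> q nl unfolding a_def by (intro power_mono) auto
    then have "16 * \<sigma>\<^sup>2 * (q / (real n * l)) \<le> a\<^sup>2"
      using q nl by (simp add: power_mult_distrib)
    then have sig: "16 * \<sigma>\<^sup>2 * q \<le> a\<^sup>2 * (real n * l)"
      using nl by (simp add: pos_divide_le_eq)
    \<comment> \<open>This is the minimiser a / (\<sigma>^2 V) for V = 8 / (3 n l), taken at the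
      threshold a^2 = 16 \<sigma>^2 q / (n l). Written through q and a it remains meaningful for
      \<sigma> = 0. The linear term is 6 q and the quadratic one at most 3 q.\<close>
    define \<theta> where "\<theta> = 6 * q / a"
    have "\<sigma>\<^sup>2 * \<theta>\<^sup>2 * (2 / (3 / 4 * real n * l)) / 2 = (16 * \<sigma>\<^sup>2 * q) * (3 * q) / (a\<^sup>2 * (real n * l))"
      using a nl by (simp add: \<theta>_def power2_eq_square field_simps)
    also have "\<dots> \<le> (a\<^sup>2 * (real n * l)) * (3 * q) / (a\<^sup>2 * (real n * l))"
      using a nl q by (intro divide_right_mono mult_right_mono sig) auto
    also have "\<dots> = 3 * q" using a n0 l by simp
    finally have bound: "\<sigma>\<^sup>2 * \<theta>\<^sup>2 * (2 / (3 / 4 * real n * l)) / 2 - \<theta> * a \<le> - 3 * q"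
      using a by (simp add: \<theta>_def)
    have \<theta>0: "0 \<le> \<theta>" using a q by (simp add: \<theta>_def)
    have "prob (Bad t) = prob {\<omega> \<in> G. a \<le> (\<Sum>k<p. h k * d \<omega> k)}"
      by (simp add: Bad_def tt hd a_def)
    also have "\<dots> \<le> exp (\<sigma>\<^sup>2 * \<theta>\<^sup>2 * ((\<Sum>k<p. (h k)\<^sup>2) / (3 / 4 * real n * l)) / 2 - \<theta> * a)"
      by (rule least_squares_error_tail[OF _ K indep X noise G(1) lower normal_eq \<theta>0]) auto
    also have "\<dots> \<le> exp (- 3 * q)" unfolding h2 using bound by simp
    finally show ?thesis .
  qed
  have TM: "T \<in> events"
  proof -
    have "is_top_index_set (card ?S) (map_vec abs (b \<omega>)) ?S
        \<longleftrightarrow> (\<forall>i\<in>?S. \<forall>j\<in>{..<p} - ?S. \<bar>b \<omega> $ j\<bar> < \<bar>b \<omega> $ i\<bar>)" if "\<omega> \<in> space M" for \<omega>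
      using carrier_vecD[OF bc[OF that]] S by (auto simp: is_top_index_set_def subset_iff)
    then have "T = {\<omega> \<in> space M. \<forall>i\<in>?S. \<forall>j\<in>{..<p} - ?S. \<bar>b \<omega> $ j\<bar> < \<bar>b \<omega> $ i\<bar>}"
      unfolding T_def by auto
    also have "\<dots> \<in> events"
    proof (intro sets.sets_Collect_finite_All)
      fix i j assume "i \<in> ?S" "j \<in> {..<p} - ?S"
      then have [measurable]: "(\<lambda>\<omega>. b \<omega> $ i) \<in> borel_measurable M" "(\<lambda>\<omega>. b \<omega> $ j) \<in> borel_measurable M"
        using S by (auto intro!: bj)
      show "{\<omega> \<in> space M. \<bar>b \<omega> $ j\<bar> < \<bar>b \<omega> $ i\<bar>} \<in> events" by measurable
    qed (use finS in auto)
    finally show ?thesis .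
  qed
  have "space M - T \<subseteq> (space M - G) \<union> (\<Union>t\<in>J. Bad t)"
  proof
    fix \<omega> assume \<omega>: "\<omega> \<in> space M - T"
    show "\<omega> \<in> (space M - G) \<union> (\<Union>t\<in>J. Bad t)"
    proof (cases "\<omega> \<in> G")
      case True
      have "\<not> is_top_index_set (card ?S) (map_vec abs (b \<omega>)) ?S" using \<omega> by (auto simp: T_def)
      from not_top_index_set_imp_large_contrast[OF bc \<beta> this] \<omega>
      obtain i j s where "(i, j, s) \<in> J" "\<bar>\<beta> $ i\<bar> \<le> - sgn (\<beta> $ i) * d \<omega> i + s * d \<omega> j"
        unfolding J_def d_def by blast
      with True have "\<omega> \<in> Bad (i, j, s)" "(i, j, s) \<in> J" by (auto simp: Bad_def)
      then show ?thesis by blast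
    qed (use \<omega> in auto)
  qed
  then have "prob (space M - T) \<le> prob ((space M - G) \<union> (\<Union>t\<in>J. Bad t))"
    using GM BadM finJ by (intro finite_measure_mono sets.Un sets.finite_UN) auto
  also have "\<dots> \<le> prob (space M - G) + prob (\<Union>t\<in>J. Bad t)"
    using GM BadM finJ by (intro measure_Un_le sets.finite_UN) auto
  also have "\<dots> \<le> exp (- real p) + (\<Sum>t\<in>J. prob (Bad t))"
    using G(2) BadM finJ by (intro add_mono finite_measure_subadditive_finite) auto
  also have "\<dots> \<le> exp (- real p) + real (card J) * exp (- 3 * q)"
    using sum_bounded_above[of J "\<lambda>t. prob (Bad t)", OF Badp] by simp
  also have "\<dots> \<le> exp (- real p) + 2 * (real p)\<^sup>2 * exp (- 3 * q)"
    by (intro add_left_mono mult_right_mono cardJ) simp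
  finally show ?thesis
    using prob_compl[OF TM] by (simp add: T_def)
qed

text \<open>All data vary with n, as in a triangular array. The quantifier over \<open>l\<close>
  stands inside the filter: the sample size from which the bounds hold depends on the sequence
  \<open>p\<close> alone, through 4800 p \<le> n.\<close>

theorem theorem4p1:
  fixes M :: "nat \<Rightarrow> 'a measure"
    and p :: "nat \<Rightarrow> nat"
    and \<Sigma> :: "nat \<Rightarrow> real mat"
    and \<beta> :: "nat \<Rightarrow> real Matrix.vec"
    and \<sigma> :: "nat \<Rightarrow> real"
    and x :: "nat \<Rightarrow> nat \<Rightarrow> 'a \<Rightarrow> real Matrix.vec"
    and \<epsilon> y :: "nat \<Rightarrow> nat \<Rightarrow> 'a \<Rightarrow> real"
    and \<beta>hat :: "nat \<Rightarrow> 'a \<Rightarrow> real Matrix.vec"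
  assumes prob: "\<And>n. prob_space (M n)"
    and p_pos: "\<And>n. 0 < p n"
    and p_over_n: "(\<lambda>n. real (p n) / real n) \<longlonglongrightarrow> 0"
    and beta_dim: "\<And>n. \<beta> n \<in> carrier_vec (p n)"
    and sigma_nonneg: "\<And>n. 0 \<le> \<sigma> n"
    and design: "\<And>n i. i \<in> {1..n} \<Longrightarrow> multivariate_normal (M n) (p n) (0\<^sub>v (p n)) (\<Sigma> n) (x n i)"
    and noise: "\<And>n i. i \<in> {1..n} \<Longrightarrow> sub_gaussian (M n) (\<sigma> n) (\<epsilon> n i)"
    and indep: "\<And>n. indep_design_noise (M n) (p n) {1..n} (x n) (\<epsilon> n)"
    and model: "\<And>n i \<omega>. i \<in> {1..n} \<Longrightarrow> \<omega> \<in> space (M n) \<Longrightarrow> y n i \<omega> = x n i \<omega> \<bullet> \<beta> n + \<epsilon> n i \<omega>"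
    and OLS_measurable: "\<And>n. \<beta>hat n \<in> M n \<rightarrow>\<^sub>M vec_borel (p n)"
    and OLS: "\<And>n \<omega>. \<omega> \<in> space (M n) \<Longrightarrow>
      is_OLS n (p n) (\<lambda>i. x n i \<omega>) (\<lambda>i. y n i \<omega>) (\<beta>hat n \<omega>)"
  shows
    "(\<forall>\<^sub>F n in sequentially. \<forall>l.
        0 < l \<and> l < lambda_min (\<Sigma> n) \<and>
        (\<forall>j\<in>supp_vec (\<beta> n). \<bar>\<beta> n $ j\<bar> > 4 * \<sigma> n * sqrt (ln (real (p n)) / (real n * l)))
        \<longrightarrow> measure (M n) {\<omega> \<in> space (M n).
              is_top_index_set (card (supp_vec (\<beta> n))) (map_vec abs (\<beta>hat n \<omega>)) (supp_vec (\<beta> n))}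
            \<ge> 1 - exp (- real (p n)) - 2 * exp (- ln (real (p n)))) \<and>
     (\<forall>\<^sub>F n in sequentially. \<forall>l.
        0 < l \<and> l < lambda_min (\<Sigma> n) \<and>
        (\<forall>j\<in>supp_vec (\<beta> n). \<bar>\<beta> n $ j\<bar> > 4 * \<sigma> n * sqrt (real (p n) / (real n * l)))
        \<longrightarrow> measure (M n) {\<omega> \<in> space (M n).
              is_top_index_set (card (supp_vec (\<beta> n))) (map_vec abs (\<beta>hat n \<omega>)) (supp_vec (\<beta> n))}
            \<ge> 1 - exp (- real (p n)) - 2 * real (p n) * exp (- 2 * real (p n)))"
proof (rule conjI)
  have "\<forall>\<^sub>F n in sequentially. real (p n) / real n < 1 / 4800"
    by (rule order_tendstoD(2)[OF p_over_n]) simp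
  \<comment> \<open>The case n = 0 is excluded separately: the quotient there is 0 because division
    by 0 gives 0.\<close>
  then have large: "\<forall>\<^sub>F n in sequentially. 4800 * real (p n) \<le> real n"
    using eventually_gt_at_top[of 0] by eventually_elim (simp add: field_simps)
  let ?top = "\<lambda>n. {\<omega> \<in> space (M n).
    is_top_index_set (card (supp_vec (\<beta> n))) (map_vec abs (\<beta>hat n \<omega>)) (supp_vec (\<beta> n))}"
  have main: "1 - exp (- real (p n)) - 2 * (real (p n))\<^sup>2 * exp (- 3 * q) \<le> measure (M n) (?top n)"
    if "4800 * real (p n) \<le> real n" "0 \<le> q" "0 < l" "l < lambda_min (\<Sigma> n)"
      "\<And>j. j \<in> supp_vec (\<beta> n) \<Longrightarrow> 4 * \<sigma> n * sqrt (q / (real n * l)) < \<bar>\<beta> n $ j\<bar>" for n q l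
    by (rule prob_space.top_index_set_probability[OF prob that(1) p_pos beta_dim design noise indep model
        OLS_measurable OLS sigma_nonneg that(2-5)])
  show "\<forall>\<^sub>F n in sequentially. \<forall>l.
        0 < l \<and> l < lambda_min (\<Sigma> n) \<and>
        (\<forall>j\<in>supp_vec (\<beta> n). \<bar>\<beta> n $ j\<bar> > 4 * \<sigma> n * sqrt (ln (real (p n)) / (real n * l)))
        \<longrightarrow> measure (M n) (?top n) \<ge> 1 - exp (- real (p n)) - 2 * exp (- ln (real (p n)))"
    using large
  proof (eventually_elim, intro allI impI, elim conjE)
    fix n l
    assume n: "4800 * real (p n) \<le> real n" and l: "0 < l" "l < lambda_min (\<Sigma> n)"
      and signal: "\<forall>j\<in>supp_vec (\<beta> n). \<bar>\<beta> n $ j\<bar> > 4 * \<sigma> n * sqrt (ln (real (p n)) / (real n * l))"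
    define P where "P = real (p n)"
    have P: "0 < P" using p_pos[of n] by (simp add: P_def)
    \<comment> \<open>With q = ln p the union bound is 2 p^2 / p^3 = 2 / p, exactly the allowed 2
      exp (- ln p).\<close>
    have "exp (3 * ln P) = P ^ 3" using exp_of_nat_mult[of 3 "ln P"] P by simp
    then have "P\<^sup>2 * exp (- 3 * ln P) = exp (- ln P)"
      using P by (simp add: exp_minus power2_eq_square power3_eq_cube divide_simps)
    then show "1 - exp (- real (p n)) - 2 * exp (- ln (real (p n))) \<le> measure (M n) (?top n)"
      using main[OF n _ l, of "ln (real (p n))"] signal p_pos[of n] by (simp add: P_def mult.assoc)
  qed
  show "\<forall>\<^sub>F n in sequentially. \<forall>l.
        0 < l \<and> l < lambda_min (\<Sigma> n) \<and>
        (\<forall>j\<in>supp_vec (\<beta> n). \<bar>\<beta> n $ j\<bar> > 4 * \<sigma> n * sqrt (real (p n) / (real n * l)))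
        \<longrightarrow> measure (M n) (?top n) \<ge> 1 - exp (- real (p n)) - 2 * real (p n) * exp (- 2 * real (p n))"
    using large
  proof (eventually_elim, intro allI impI, elim conjE)
    fix n l
    assume n: "4800 * real (p n) \<le> real n" and l: "0 < l" "l < lambda_min (\<Sigma> n)"
      and signal: "\<forall>j\<in>supp_vec (\<beta> n). \<bar>\<beta> n $ j\<bar> > 4 * \<sigma> n * sqrt (real (p n) / (real n * l))"
    \<comment> \<open>The inequality p \<le> exp p trades one factor p of the union bound 2 p^2 exp
      (- 3 p) for a factor exp p.\<close>
    have "real (p n) * exp (- real (p n)) \<le> 1"
      using order_trans[OF _ exp_ge_add_one_self, of "real (p n)" "real (p n)"]
      by (simp add: exp_minus field_simps)
    then have "(2 * real (p n) * exp (- 2 * real (p n))) * (real (p n) * exp (- real (p n)))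
        \<le> (2 * real (p n) * exp (- 2 * real (p n))) * 1"
      by (intro mult_left_mono) auto
    also have "(2 * real (p n) * exp (- 2 * real (p n))) * (real (p n) * exp (- real (p n)))
        = 2 * (real (p n))\<^sup>2 * (exp (- 2 * real (p n)) * exp (- real (p n)))"
      by (simp add: power2_eq_square)
    also have "exp (- 2 * real (p n)) * exp (- real (p n)) = exp (- 3 * real (p n))"
      by (simp add: exp_add[symmetric])
    finally have "2 * (real (p n))\<^sup>2 * exp (- 3 * real (p n)) \<le> 2 * real (p n) * exp (- 2 * real (p n))"
      by simp
    moreover have "1 - exp (- real (p n)) - 2 * (real (p n))\<^sup>2 * exp (- 3 * real (p n)) \<le> measure (M n) (?top n)"
      by (rule main[OF n _ l]) (use signal in auto)
    ultimately show "1 - exp (- real (p n)) - 2 * real (p n) * exp (- 2 * real (p n)) \<le> measure (M n) (?top n)"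
      by linarith
  qed
qed

end
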